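(* Let $1\le k\le n$ be integers and $m=k(n-1)-\binom{k}{2}$. Let $\alpha_1,\dots,\alpha_m\in(\mathbb{Z}/2)^k$ and let $V=\bigoplus_{i=1}^m V_{\alpha_i}$. If $$r\bigl(\underbrace{n-1,\dots,n-1}_{k\text{ times}};\ V\oplus\bigoplus_{\alpha\in(\mathbb{Z}/2)^k,\ |\alpha|=2}V_\alpha\bigr)=1,$$ then there is no continuous $(\mathbb{Z}/2)^k$-equivariant map $V_{n,k}\longrightarrow S(V)$.
   Context: Let $\varepsilon_1,\dots,\varepsilon_k$ be the standard generators of $(\mathbb{Z}/2)^k$, with $\mathbb{Z}/2=\{0,1\}$ written additively, and let $\langle\alpha,\beta\rangle=\sum_j\alpha_j\beta_j\in\mathbb{Z}/2$. For $\alpha\in(\mathbb{Z}/2)^k$, $|\alpha|$ is the number of non-zero entries of $\alpha$, and $V_\alpha$ is the real line $\mathbb{R}$ with the $(\mathbb{Z}/2)^k$-action in which $\varepsilon_j$ acts by $x\mapsto -x$ if $\langle\varepsilon_j,\alpha\rangle=1$ and trivially otherwise. $S(V)$ is the unit sphere of $V$ (with the coordinate inner product). $V_{n,k}\subset(S^{n-1})^k$ is the Stiefel manifold of $k$-tuples of pairwise orthonormal vectors in $\mathbb{R}^n$, with $\varepsilon_j$ acting by $x_j\mapsto -x_j$ and fixing the other vectors. Definition of $r$. Let $n_1,\dots,n_k\ge 0$ be integers, $N=n_1+\dots+n_k$, and let $U=\bigoplus_{i=1}^{N}V_{\beta_i}$ with $\beta_i\in(\mathbb{Z}/2)^k$,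 so $\dim U=N$. The group $(\mathbb{Z}/2)^k$ acts on $S^{n_1}\times\dots\times S^{n_k}$ by letting $\varepsilon_j$ act as the antipodal map on the $j$th factor and trivially on the others. Let $B^{n_i}\subset S^{n_i}\subset\mathbb{R}^{n_i+1}$ be the closed upper hemisphere, i.e. the points with last coordinate $\ge 0$ (a single point if $n_i=0$), and $B=B^{n_1}\times\dots\times B^{n_k}$, an $N$-dimensional ball with boundary $\partial B$. For a continuous equivariant map $f\colon S^{n_1}\times\dots\times S^{n_k}\to U$ with no zeros on $\partial B$ and with only isolated zeros, let $\widehat f\colon\partial B\to S(U)$, $\widehat f(x)=f(x)/|f(x)|$. Then $r(n_1,\dots,n_k;U)\in\mathbb{Z}/2$ is the degree of $\widehat f$ modulo $2$; it does not depend on the choice of $f$. (If $N=1$, the degree of a map $S^0\to S^0$ is taken in reduced homology; if $N=0$, $r=1$.) *)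

theory Defs
  imports "HOL-Homology.Homology" "HOL-Library.Z2"
begin

text \<open>
  Conventions. Following the library's \<^const>\<open>Euclidean_space\<close> and \<^const>\<open>nsphere\<close>, a vector of
  \<open>\<real>\<^sup>m\<close> is a function \<open>nat \<Rightarrow> real\<close> vanishing at all indices \<open>\<ge> m\<close>, and indices start at 0, so the
  last coordinate on the sphere \<open>S\<^sup>n\<close> is the one with index \<open>n\<close>.
  Likewise an element of \<open>(\<int>/2)\<^sup>k\<close> is a function \<open>nat \<Rightarrow> bit\<close> vanishing at all indices \<open>\<ge> k\<close>.
  A \<open>k\<close>-tuple of vectors is an extensional function on \<open>{..<k}\<close>, as in \<^const>\<open>product_topology\<close>.
  The direct sum of the lines \<open>V\<^bsub>\<alpha>\<^esub>\<close> over a list \<open>\<alpha>s\<close> of weights has underlying space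
  \<open>Euclidean_space (length \<alpha>s)\<close>, the \<open>i\<close>-th coordinate carrying the weight \<open>\<alpha>s ! i\<close>.
\<close>

subsection \<open>The group and its real representations\<close>

definition Z2pow :: "nat \<Rightarrow> (nat \<Rightarrow> bit) set"
  where "Z2pow k = {\<alpha>. \<forall>j\<ge>k. \<alpha> j = 0}"

definition Z2gen :: "nat \<Rightarrow> nat \<Rightarrow> bit"
  where "Z2gen j = (\<lambda>i. if i = j then 1 else 0)"

definition Z2pair :: "nat \<Rightarrow> (nat \<Rightarrow> bit) \<Rightarrow> (nat \<Rightarrow> bit) \<Rightarrow> bit"
  where "Z2pair k \<alpha> \<beta> = (\<Sum>j<k. \<alpha> j * \<beta> j)"

definition Z2weight :: "nat \<Rightarrow> (nat \<Rightarrow> bit) \<Rightarrow> nat"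
  where "Z2weight k \<alpha> = card {j. j < k \<and> \<alpha> j \<noteq> 0}"

text \<open>
  The two actions below are given for arbitrary group elements \<open>g\<close>; at \<open>g = Z2gen j\<close> they are the
  prescribed actions of the standard generators (see the lemmas that follow).
\<close>

definition line_action :: "nat \<Rightarrow> (nat \<Rightarrow> bit) \<Rightarrow> (nat \<Rightarrow> bit) \<Rightarrow> real \<Rightarrow> real"
  where "line_action k \<alpha> g x = (if Z2pair k g \<alpha> = 1 then - x else x)"

definition rep_action ::
    "nat \<Rightarrow> (nat \<Rightarrow> bit) list \<Rightarrow> (nat \<Rightarrow> bit) \<Rightarrow> (nat \<Rightarrow> real) \<Rightarrow> nat \<Rightarrow> real"
  where "rep_action k \<alpha>s g v = (\<lambda>i. if i < length \<alpha>s then line_action k (\<alpha>s ! i) g (v i) else 0)"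

definition tuple_action ::
    "nat \<Rightarrow> (nat \<Rightarrow> bit) \<Rightarrow> (nat \<Rightarrow> nat \<Rightarrow> real) \<Rightarrow> nat \<Rightarrow> nat \<Rightarrow> real"
  where "tuple_action k g x = (\<lambda>j\<in>{..<k}. if g j = 1 then (\<lambda>l. - x j l) else x j)"

lemma Z2pair_gen: "j < k \<Longrightarrow> Z2pair k (Z2gen j) \<alpha> = \<alpha> j"
proof -
  assume "j < k"
  have "Z2pair k (Z2gen j) \<alpha> = (\<Sum>i<k. if i = j then \<alpha> i else 0)"
    unfolding Z2pair_def Z2gen_def by (intro sum.cong) auto
  also have "\<dots> = \<alpha> j"
    using \<open>j < k\<close> by (subst sum.delta) auto
  finally show ?thesis .
qed

lemma tuple_action_gen:
  assumes "x \<in> extensional {..<k}" "j < k"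
  shows "tuple_action k (Z2gen j) x = x(j := (\<lambda>l. - x j l))"
  using assms by (auto simp: tuple_action_def Z2gen_def extensional_def)

definition tuple_equivariant ::
    "nat \<Rightarrow> (nat \<Rightarrow> nat \<Rightarrow> real) topology \<Rightarrow> (nat \<Rightarrow> bit) list
      \<Rightarrow> ((nat \<Rightarrow> nat \<Rightarrow> real) \<Rightarrow> nat \<Rightarrow> real) \<Rightarrow> bool"
  where "tuple_equivariant k X \<alpha>s f \<longleftrightarrow>
    (\<forall>g\<in>Z2pow k. \<forall>x\<in>topspace X. f (tuple_action k g x) = rep_action k \<alpha>s g (f x))"

subsection \<open>Spaces\<close>

text \<open>The unit sphere of \<open>\<real>\<^sup>m\<close>, which is empty for \<open>m = 0\<close>.\<close>

definition unit_sphere :: "nat \<Rightarrow> (nat \<Rightarrow> real) topology"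
  where "unit_sphere m = subtopology (Euclidean_space m) {x. (\<Sum>i<m. (x i)\<^sup>2) = 1}"

lemma unit_sphere_0: "topspace (unit_sphere 0) = {}"
  by (simp add: unit_sphere_def)

lemma unit_sphere_Suc: "unit_sphere (Suc p) = nsphere p"
  by (simp add: unit_sphere_def nsphere_def lessThan_Suc_atMost)

definition sphere_product :: "nat \<Rightarrow> (nat \<Rightarrow> nat) \<Rightarrow> (nat \<Rightarrow> nat \<Rightarrow> real) topology"
  where "sphere_product k ns = product_topology (\<lambda>j. nsphere (ns j)) {..<k}"

definition stiefel :: "nat \<Rightarrow> nat \<Rightarrow> (nat \<Rightarrow> nat \<Rightarrow> real) topology"
  where "stiefel n k = subtopology (sphere_product k (\<lambda>_. n - 1))
    {x. \<forall>i<k. \<forall>j<k. i \<noteq> j \<longrightarrow> (\<Sum>l<n. x i l * x j l) = 0}"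

definition hemisphere_product :: "nat \<Rightarrow> (nat \<Rightarrow> nat) \<Rightarrow> (nat \<Rightarrow> nat \<Rightarrow> real) topology"
  where "hemisphere_product k ns = subtopology (sphere_product k ns) {x. \<forall>j<k. 0 \<le> x j (ns j)}"

text \<open>
  The boundary of the ball \<open>B\<close>: some component lies on the equator of its sphere. A factor
  with \<open>ns j = 0\<close> is the single point with coordinate 1 and contributes nothing.
\<close>

definition hemisphere_boundary :: "nat \<Rightarrow> (nat \<Rightarrow> nat) \<Rightarrow> (nat \<Rightarrow> nat \<Rightarrow> real) topology"
  where "hemisphere_boundary k ns =
    subtopology (hemisphere_product k ns) {x. \<exists>j<k. x j (ns j) = 0}"

subsection \<open>The invariant \<open>r\<close>\<close>

text \<open>
  The degree mod 2 of a map to \<open>nsphere p\<close> from a space \<open>X\<close> homeomorphic to \<open>nsphere p\<close>. The library's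
  Brouwer degree is defined via reduced homology, hence also meaningful for \<open>p = 0\<close>. Changing the
  homeomorphism changes the integral degree at most by a sign.
\<close>

definition degree_mod2 :: "nat \<Rightarrow> 'a topology \<Rightarrow> ('a \<Rightarrow> nat \<Rightarrow> real) \<Rightarrow> bit"
  where "degree_mod2 p X h = (THE d. \<exists>\<phi>. homeomorphic_map (nsphere p) X \<phi> \<and>
    d = of_int (Brouwer_degree2 p (h \<circ> \<phi>)))"

lemma degree_mod2_eq:
  assumes h: "continuous_map X (nsphere p) h" and phi: "homeomorphic_map (nsphere p) X \<phi>"
  shows "degree_mod2 p X h = of_int (Brouwer_degree2 p (h \<circ> \<phi>))"
  unfolding degree_mod2_def
proof (rule the_equality)
  fix d :: bit
  assume "\<exists>\<psi>. homeomorphic_map (nsphere p) X \<psi> \<and> d = of_int (Brouwer_degree2 p (h \<circ> \<psi>))"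
  then obtain \<psi> where psi: "homeomorphic_map (nsphere p) X \<psi>"
    and d: "d = of_int (Brouwer_degree2 p (h \<circ> \<psi>))"
    by blast
  obtain \<phi>' where phi': "homeomorphic_maps (nsphere p) X \<phi> \<phi>'"
    using phi homeomorphic_map_maps by blast
  have theta: "homeomorphic_map (nsphere p) (nsphere p) (\<phi>' \<circ> \<psi>)"
    using psi phi' homeomorphic_map_compose homeomorphic_maps_map by blast
  then have "\<bar>Brouwer_degree2 p (\<phi>' \<circ> \<psi>)\<bar> = 1"
    using Brouwer_degree2_homeomorphic_maps homeomorphic_map_maps by blast
  then have unit: "(of_int (Brouwer_degree2 p (\<phi>' \<circ> \<psi>)) :: bit) = 1"
    by (auto simp: abs_if split: if_splits)
  have "Brouwer_degree2 p (h \<circ> \<psi>) = Brouwer_degree2 p ((h \<circ> \<phi>) \<circ> (\<phi>' \<circ> \<psi>))"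
  proof (rule Brouwer_degree2_eq)
    fix x assume "x \<in> topspace (nsphere p)"
    then have "\<psi> x \<in> topspace X"
      using psi homeomorphic_imp_surjective_map by blast
    then show "(h \<circ> \<psi>) x = ((h \<circ> \<phi>) \<circ> (\<phi>' \<circ> \<psi>)) x"
      using phi' by (simp add: homeomorphic_maps_def)
  qed
  also have "\<dots> = Brouwer_degree2 p (h \<circ> \<phi>) * Brouwer_degree2 p (\<phi>' \<circ> \<psi>)"
    using h phi theta
    by (intro Brouwer_degree2_compose)
      (auto intro: continuous_map_compose homeomorphic_imp_continuous_map)
  finally show "d = of_int (Brouwer_degree2 p (h \<circ> \<phi>))"
    using d unit by simp
qed (use phi in blast)

definition normalize_map :: "nat \<Rightarrow> ('a \<Rightarrow> nat \<Rightarrow> real) \<Rightarrow> 'a \<Rightarrow> nat \<Rightarrow> real"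
  where "normalize_map m f x = (\<lambda>i. f x i / sqrt (\<Sum>l<m. (f x l)\<^sup>2))"

definition zeros_of :: "'a topology \<Rightarrow> ('a \<Rightarrow> nat \<Rightarrow> real) \<Rightarrow> 'a set"
  where "zeros_of X f = {x \<in> topspace X. f x = (\<lambda>_. 0)}"

definition admissible_map ::
    "nat \<Rightarrow> (nat \<Rightarrow> nat) \<Rightarrow> (nat \<Rightarrow> bit) list \<Rightarrow> ((nat \<Rightarrow> nat \<Rightarrow> real) \<Rightarrow> nat \<Rightarrow> real) \<Rightarrow> bool"
  where "admissible_map k ns \<beta>s f \<longleftrightarrow>
    continuous_map (sphere_product k ns) (Euclidean_space (length \<beta>s)) f \<and>
    tuple_equivariant k (sphere_product k ns) \<beta>s f \<and>
    zeros_of (hemisphere_boundary k ns) f = {} \<and>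
    (\<forall>x \<in> zeros_of (sphere_product k ns) f.
       \<exists>W. openin (sphere_product k ns) W \<and> W \<inter> zeros_of (sphere_product k ns) f = {x})"

text \<open>
  This is meant for \<open>length \<beta>s = (\<Sum>j<k. ns j)\<close> and weights \<open>\<beta>s\<close> in \<open>Z2pow k\<close>. The description
  operator reflects that the degree does not depend on the choice of the admissible map. For
  \<open>N > 0\<close> the unit sphere of the representation is \<open>nsphere (N - 1)\<close>, see \<open>unit_sphere_Suc\<close>.
\<close>

definition r_invariant :: "nat \<Rightarrow> (nat \<Rightarrow> nat) \<Rightarrow> (nat \<Rightarrow> bit) list \<Rightarrow> bit"
  where "r_invariant k ns \<beta>s =
    (let N = \<Sum>j<k. ns j in
     if N = 0 then 1
     else THE d. \<exists>f. admissible_map k ns \<beta>s f \<and>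
            d = degree_mod2 (N - 1) (hemisphere_boundary k ns) (normalize_map N f))"

end

(*
  Tietze's theorem and averaging over the group extend an equivariant map V_{n,k} -> S(V) to an
  equivariant map (S^(n-1))^k -> V. Adding the inner products <x_a, x_b>, a < b, which span copies of
  the V_alpha with |alpha| = 2, gives an equivariant map F without zeros. So it has to be shown
  that the mere existence of F makes the degree of every admissible map g even.

  The product of spheres has an equivariant cell structure by products of hemispheres with top
  cell B. Fundamental chains c_I of the cells satisfy the cellular boundary formula. The family
  d_I = F c_I - g c_I, defined on all cells in the boundary of B, satisfies it as well, and
  equivariant obstruction theory shows that F(bd c_B) - g(bd c_B) is an even class in the homology of
  S(U), because each wall of B contributes a class together with its image under a reflection.
  As F is defined on all of B, F(bd c_B) bounds, so the image under g of the cycle bd c_B is even.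
  The cycle itself is not even in the homology of the boundary of B, by excision and induction on
  the dimension of the cell, hence the degree of g is even.
*)
theory Submission
  imports Defs "HOL-Analysis.Urysohn"
begin

section \<open>Homology classes divisible by two\<close>

text \<open>On the boundary of \<open>B\<close> the normalised maps \<open>F\<close> and
  \<open>g\<close> need not be equivariantly homotopic: that boundary has the same dimension as the
  sphere of \<open>U\<close>, so an obstruction remains on its top cells, and only its total modulo
  two can be controlled. Working with chains instead of homotopies makes the obstructions on smaller
  cells reduced cycles in a sphere, which bound below its dimension. Degrees are defined through
  integral homology, hence vanishing modulo two is expressed as divisibility of integral classes by
  two, and the signs of the cellular formula have to be kept. The group permutes the cells freely,
  so chains are chosen only on products of upper hemispheres; every other cell is reached by flips.
  The cycle on the boundary of \<open>B\<close> is never shown to generate the homology; that it is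
  not even is enough to conclude.\<close>

definition divisible2 :: "nat \<Rightarrow> 'a topology \<Rightarrow> 'a set \<Rightarrow> 'a chain \<Rightarrow> bool"
  where "divisible2 q X S c \<longleftrightarrow>
    (\<exists>y. singular_relcycle q X S y \<and> homologous_rel q X S c (frag_cmul 2 y))"

lemma frag_cmul_diff_right: "frag_cmul a (c - d) = frag_cmul a c - frag_cmul a d"
  by (rule poly_mapping_eqI) (simp add: lookup_minus algebra_simps)

lemma homologous_rel_cmul:
  assumes "homologous_rel q X S c d"
  shows "homologous_rel q X S (frag_cmul a c) (frag_cmul a d)"
  using assms unfolding homologous_rel_def
  by (metis frag_cmul_diff_right singular_relboundary_cmul)

lemma divisible2_chain_map:
  assumes "divisible2 q X S c" "continuous_map X Y f" "f \<in> S \<rightarrow> T"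
  shows "divisible2 q Y T (chain_map q f c)"
proof -
  obtain y where y: "singular_relcycle q X S y" "singular_relboundary q X S (c - frag_cmul 2 y)"
    using assms(1) by (auto simp: divisible2_def homologous_rel_def)
  have "singular_relboundary q Y T (chain_map q f (c - frag_cmul 2 y))"
    using singular_relboundary_chain_map[OF y(2) assms(2,3)] .
  then have "homologous_rel q Y T (chain_map q f c) (frag_cmul 2 (chain_map q f y))"
    by (simp add: homologous_rel_def chain_map_diff)
  then show ?thesis
    using singular_relcycle_chain_map[OF y(1) assms(2,3)] by (auto simp: divisible2_def)
qed

lemma divisible2_add_boundary:
  assumes "divisible2 q X S c" "singular_relboundary q X S b"
  shows "divisible2 q X S (c + b)"
proof -
  obtain y where y: "singular_relcycle q X S y" "singular_relboundary q X S (c - frag_cmul 2 y)"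
    using assms(1) by (auto simp: divisible2_def homologous_rel_def)
  have "c + b - frag_cmul 2 y = (c - frag_cmul 2 y) + b" by simp
  then have "singular_relboundary q X S (c + b - frag_cmul 2 y)"
    using singular_relboundary_add[OF y(2) assms(2)] by metis
  then show ?thesis using y(1) by (auto simp: divisible2_def homologous_rel_def)
qed

lemma divisible2_cong:
  assumes "homologous_rel q X S c c'"
  shows "divisible2 q X S c \<longleftrightarrow> divisible2 q X S c'"
  using assms homologous_rel_sym homologous_rel_trans unfolding divisible2_def by metis

lemma divisible2_cmul:
  assumes "divisible2 q X S c"
  shows "divisible2 q X S (frag_cmul a c)"
proof -
  obtain y where y: "singular_relcycle q X S y" "homologous_rel q X S c (frag_cmul 2 y)"
    using assms(1) by (auto simp: divisible2_def)
  have "homologous_rel q X S (frag_cmul a c) (frag_cmul 2 (frag_cmul a y))"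
    using homologous_rel_cmul[OF y(2), of a] by (simp add: mult.commute)
  then show ?thesis using singular_relcycle_cmul[OF y(1)] unfolding divisible2_def by blast
qed

lemma divisible2_0: "divisible2 q X S 0"
  by (auto simp: divisible2_def intro!: exI[of _ 0])

lemma divisible2_add:
  assumes "divisible2 q X S c" "divisible2 q X S d"
  shows "divisible2 q X S (c + d)"
proof -
  obtain y z where y: "singular_relcycle q X S y" "homologous_rel q X S c (frag_cmul 2 y)"
    and z: "singular_relcycle q X S z" "homologous_rel q X S d (frag_cmul 2 z)"
    using assms by (auto simp: divisible2_def)
  show ?thesis unfolding divisible2_def
    by (rule exI[of _ "y + z"])
      (use homologous_rel_add[OF y(2) z(2)] singular_relcycle_add[OF y(1) z(1)] in
        \<open>simp add: frag_cmul_distrib2\<close>)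
qed

lemma divisible2_sum:
  assumes "\<And>i. i \<in> I \<Longrightarrow> divisible2 q X S (f i)"
  shows "divisible2 q X S (sum f I)"
  using assms by (induction I rule: infinite_finite_induct) (auto simp: divisible2_0 divisible2_add)

lemma divisible2_relativize:
  assumes "divisible2 q X {} c" 
  shows "divisible2 q X S c"
proof -
  obtain y where y: "singular_relcycle q X {} y" "singular_relboundary q X {} (c - frag_cmul 2 y)"
    using assms(1) by (auto simp: divisible2_def homologous_rel_def)
  have "singular_relcycle q X S y"
    using y(1) unfolding singular_cycle by (simp add: singular_relcycle)
  moreover have "singular_relboundary q X S (c - frag_cmul 2 y)"
    using y(2) unfolding singular_relboundary by (meson empty_subsetI singular_chain_mono)
  ultimately show ?thesis by (auto simp: divisible2_def homologous_rel_def)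
qed

text \<open>The connecting homomorphism of a pair preserves divisibility: up to an absolute
  boundary, \<open>c - 2 y\<close> is a chain \<open>e\<close> in \<open>S\<close>, and the boundary
  of \<open>e\<close> bounds in \<open>S\<close>.\<close>

lemma divisible2_boundary:
  assumes "divisible2 (Suc q) X S c"
  shows "divisible2 q (subtopology X S) {} (chain_boundary (Suc q) c)"
proof -
  obtain y where y: "singular_relcycle (Suc q) X S y"
    and b: "singular_relboundary (Suc q) X S (c - frag_cmul 2 y)"
    using assms(1) by (auto simp: divisible2_def homologous_rel_def)
  obtain d e where d: "singular_chain (Suc (Suc q)) X d"
    and e: "singular_chain (Suc q) (subtopology X S) e"
    and eq: "chain_boundary (Suc (Suc q)) d + e = c - frag_cmul 2 y"
    using b by (auto simp: singular_relboundary)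
  have dd: "chain_boundary (Suc q) (chain_boundary (Suc (Suc q)) d) = 0"
    by (meson chain_boundary_boundary_alt d)
  have "chain_boundary (Suc q) (c - frag_cmul 2 y) = chain_boundary (Suc q) e"
    unfolding eq[symmetric] chain_boundary_add dd by simp
  then have "chain_boundary (Suc q) c - frag_cmul 2 (chain_boundary (Suc q) y) =
    chain_boundary (Suc q) e"
    by (simp add: chain_boundary_diff chain_boundary_cmul)
  moreover have "singular_relboundary q (subtopology X S) {} (chain_boundary (Suc q) e)"
    using e by (auto simp: singular_boundary)
  moreover have "singular_relcycle q (subtopology X S) {} (chain_boundary (Suc q) y)"
    using y by (cases q) (auto simp: singular_cycle singular_relcycle chain_boundary_boundary_alt)
  ultimately show ?thesis
    by (auto simp: divisible2_def homologous_rel_def)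
qed

text \<open>Excision is an isomorphism: surjectivity moves the half \<open>y\<close> into the
  smaller pair, and injectivity then brings back the relation between \<open>c\<close> and its
  double.\<close>

lemma divisible2_excision:
  assumes div: "divisible2 q X T c" and U: "X closure_of U \<subseteq> X interior_of T"
    and T: "T \<subseteq> topspace X"
    and c: "singular_relcycle q (subtopology X (topspace X - U)) (T - U) c"
  shows "divisible2 q (subtopology X (topspace X - U)) (T - U) c"
proof -
  let ?E = "subtopology X (topspace X - U)"
  let ?h = "hom_induced (int q) ?E (T - U) X T id"
  have iso: "?h \<in>
    iso (relative_homology_group (int q) ?E (T - U)) (relative_homology_group (int q) X T)"
    using homology_excision_axiom[OF U T, of "int q"] by simp
  have ind: "?h (homologous_rel_set q ?E (T - U) z) = homologous_rel_set q X T z"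
    if "singular_relcycle q ?E (T - U) z" for z
  proof -
    have "?h (homologous_rel_set q ?E (T - U) z) = homologous_rel_set q X T (chain_map q id z)"
      using that by (intro hom_induced_chain_map) auto
    then show ?thesis
      using that by (metis chain_map_ident singular_relcycle)
  qed
  obtain y where y: "singular_relcycle q X T y" "homologous_rel q X T c (frag_cmul 2 y)"
    using div by (auto simp: divisible2_def)
  have "homologous_rel_set q X T y \<in> ?h ` carrier (relative_homology_group (int q) ?E (T - U))"
    using iso y(1) by (auto simp: iso_def bij_betw_def carrier_relative_homology_group)
  then obtain y' where y': "singular_relcycle q ?E (T - U) y'"
    and "?h (homologous_rel_set q ?E (T - U) y') = homologous_rel_set q X T y"
    by (auto simp: carrier_relative_homology_group)
  then have "homologous_rel q X T y' y"
    using ind[OF y'] by (simp add: homologous_rel_set_eq)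
  then have "homologous_rel q X T (frag_cmul 2 y') (frag_cmul 2 y)"
    by (rule homologous_rel_cmul)
  then have "homologous_rel q X T c (frag_cmul 2 y')"
    using y(2) homologous_rel_sym homologous_rel_trans by blast
  moreover have cy: "singular_relcycle q ?E (T - U) (frag_cmul 2 y')"
    by (simp add: singular_relcycle_cmul y')
  ultimately have "?h (homologous_rel_set q ?E (T - U) c) =
    ?h (homologous_rel_set q ?E (T - U) (frag_cmul 2 y'))"
    using ind[OF c] ind[OF cy] by (simp add: homologous_rel_set_eq)
  then have "homologous_rel_set q ?E (T - U) c = homologous_rel_set q ?E (T - U) (frag_cmul 2 y')"
    using iso c cy by (auto simp: iso_def bij_betw_def inj_on_def carrier_relative_homology_group)
  then show ?thesis
    using y' by (auto simp: divisible2_def homologous_rel_set_eq)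
qed

text \<open>The only 0-chain that bounds in a point is 0, so divisibility would be an equation
  between chains; but the coefficient of the simplex is 1.\<close>

lemma not_divisible2_point:
  assumes "topspace X = {a}"
  shows "\<not> divisible2 0 X {} (frag_of (restrict (\<lambda>x. a) (standard_simplex 0)))"
proof
  assume "divisible2 0 X {} (frag_of (restrict (\<lambda>x. a) (standard_simplex 0)))"
  then obtain y where y: "singular_relcycle 0 X {} y"
    and "singular_relboundary 0 X {} (frag_of (restrict (\<lambda>x. a) (standard_simplex 0)) - frag_cmul 2 y)"
    by (auto simp: divisible2_def homologous_rel_def)
  then have "frag_of (restrict (\<lambda>x. a) (standard_simplex 0)) - frag_cmul 2 y = 0"
    using singular_boundary_singleton[OF assms] by blast
  then have "frag_of (restrict (\<lambda>x. a) (standard_simplex 0)) = frag_cmul 2 y"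
    by simp
  then have "Poly_Mapping.lookup (frag_of (restrict (\<lambda>x. a) (standard_simplex 0))) (restrict (\<lambda>x. a) (standard_simplex 0))
    = 2 * Poly_Mapping.lookup y (restrict (\<lambda>x. a) (standard_simplex 0))"
    by (metis lookup_frag_cmul)
  then show False by simp presburger
qed

section \<open>Reduced cycles and the Brouwer degree on chains\<close>

text \<open>The augmentation of a 0-chain is encoded as its image in a point, matching reduced
  homology as the kernel of the map to the homology of a point. This treats the degree on the
  0-sphere uniformly with the others.\<close>

definition reduced_cycle :: "nat \<Rightarrow> 'a topology \<Rightarrow> 'a chain \<Rightarrow> bool"
  where "reduced_cycle q X c \<longleftrightarrow> singular_relcycle q X {} c \<and>
    (q = 0 \<longrightarrow> chain_map 0 (\<lambda>_. ()) c = 0)"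

lemma reduced_cycle_class:
  assumes "reduced_cycle q X c"
  shows "homologous_rel_set q X {} c \<in> carrier (reduced_homology_group (int q) X)"
proof (cases "q = 0")
  case True
  have c: "singular_relcycle q X {} c" "chain_map q (\<lambda>_. ()) c = 0"
    using assms True by (auto simp: reduced_cycle_def)
  have "hom_induced (int q) X {} (discrete_topology {()}) {} (\<lambda>x. ()) (homologous_rel_set q X {} c)
     = homologous_rel_set q (discrete_topology {()}) {} (chain_map q (\<lambda>x. ()) c)"
    using c(1) by (intro hom_induced_chain_map) auto
  also have "\<dots> = \<one>\<^bsub>homology_group (int q) (discrete_topology {()})\<^esub>"
    unfolding c(2) one_relative_homology_group homologous_rel_set_eq_relboundary by simp
  finally show ?thesis
    unfolding carrier_reduced_homology_group kernel_def
    using c(1) by (auto simp: carrier_relative_homology_group)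
next
  case False
  then show ?thesis
    using assms
      by (simp add: un_reduced_homology_group carrier_relative_homology_group reduced_cycle_def)
qed

lemma reduced_cycle_boundary:
  assumes "trivial_group (reduced_homology_group (int q) X)" "reduced_cycle q X c"
  obtains b where "singular_chain (Suc q) X b" "chain_boundary (Suc q) b = c"
proof -
  have "homologous_rel_set q X {} c = singular_relboundary_set q X {}"
    using reduced_cycle_class[OF assms(2)] assms(1)
    by (simp add: trivial_group_def one_reduced_homology_group)
  then have "singular_relboundary q X {} c"
    by (simp add: homologous_rel_set_eq_relboundary)
  then show ?thesis using that by (auto simp: singular_boundary)
qed

lemma chain_map_unit_chain_map:
  "chain_map 0 (\<lambda>_. ()) (chain_map 0 f c) = chain_map 0 (\<lambda>_. ()) c"
  using chain_map_compose[of 0 "\<lambda>_. ()" f] by (simp add: o_def fun_eq_iff)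

lemma reduced_cycle_chain_map:
  assumes "reduced_cycle q X c" "continuous_map X Y f"
  shows "reduced_cycle q Y (chain_map q f c)"
  using assms singular_relcycle_chain_map[of q X "{}" c Y f "{}"]
  by (auto simp: reduced_cycle_def chain_map_unit_chain_map)

text \<open>The Brouwer degree acts on homology as an exponent in a group of cosets; this translates
  the exponent into a scalar multiple of a representing chain.\<close>

lemma int_pow_relative_homology_group:
  assumes "singular_relcycle q X S c"
  shows "homologous_rel_set q X S c [^]\<^bsub>relative_homology_group (int q) X S\<^esub> (a::int)
    = homologous_rel_set q X S (frag_cmul a c)"
proof -
  let ?G = "relative_homology_group (int q) X S"
  have mult: "homologous_rel_set q X S u \<otimes>\<^bsub>?G\<^esub> homologous_rel_set q X S v =
    homologous_rel_set q X S (u + v)" for u v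
  proof (intro Set.set_eqI iffI)
    fix w assume "w \<in> homologous_rel_set q X S u \<otimes>\<^bsub>?G\<^esub> homologous_rel_set q X S v"
    then obtain r s where "homologous_rel q X S u r" "homologous_rel q X S v s" "w = r + s"
      unfolding mult_relative_homology_group by auto
    then show "w \<in> homologous_rel_set q X S (u + v)"
      using homologous_rel_add by simp
  next
    fix w assume "w \<in> homologous_rel_set q X S (u + v)"
    then have "homologous_rel q X S v (w - u)"
      unfolding homologous_rel_def mem_Collect_eq by (simp add: algebra_simps)
    moreover have "w = u + (w - u)" by simp
    ultimately show "w \<in> homologous_rel_set q X S u \<otimes>\<^bsub>?G\<^esub> homologous_rel_set q X S v"
      unfolding mult_relative_homology_group using homologous_rel_refl[of q X S u] by blast
  qed
  interpret G: group ?G by simp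
  have carr: "homologous_rel_set q X S (frag_cmul b c) \<in> carrier ?G" for b
    using assms by (simp add: carrier_relative_homology_group singular_relcycle_cmul)
  have nat: "homologous_rel_set q X S c [^]\<^bsub>?G\<^esub> n = homologous_rel_set q X S (frag_cmul (int n) c)"
    for n :: nat
  proof (induction n)
    case 0
    show ?case
      using homologous_rel_set_eq_relboundary[of q X S 0] by simp
  next
    case (Suc n)
    have "frag_cmul (int n) c + c = frag_cmul (int (Suc n)) c"
      by (simp add: frag_cmul_distrib)
    then show ?case by (simp add: Suc mult del: of_nat_Suc)
  qed
  show ?thesis
  proof (cases "a \<ge> 0")
    case True
    then obtain n where "a = int n" by (metis nonneg_int_cases)
    then show ?thesis using nat[of n] by (simp add: int_pow_int)
  next
    case False
    then obtain n where n: "a = - int n" by (metis int_cases2 of_nat_0_le_iff)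
    have one: "homologous_rel_set q X S 0 = \<one>\<^bsub>?G\<^esub>"
      unfolding one_relative_homology_group homologous_rel_set_eq_relboundary by simp
    have "homologous_rel_set q X S (frag_cmul a c) \<otimes>\<^bsub>?G\<^esub> homologous_rel_set q X S (frag_cmul (-a) c) =
      \<one>\<^bsub>?G\<^esub>"
      unfolding mult frag_cmul_distrib[symmetric] using one by simp
    then have "homologous_rel_set q X S (frag_cmul a c) =
      inv\<^bsub>?G\<^esub> (homologous_rel_set q X S (frag_cmul (-a) c))"
      using G.inv_equality[OF _ carr carr] by simp
    then show ?thesis
      using nat[of n] carr[of 1] by (simp add: n G.int_pow_neg_int)
  qed
qed

lemma homologous_Brouwer_degree2:
  assumes f: "continuous_map (nsphere p) (nsphere p) f" and z: "reduced_cycle p (nsphere p) z"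
  shows "homologous_rel p (nsphere p) {} (chain_map p f z) (frag_cmul (Brouwer_degree2 p f) z)"
proof -
  let ?G = "reduced_homology_group (int p) (nsphere p)"
  have zc: "singular_relcycle p (nsphere p) {} z" using z by (simp add: reduced_cycle_def)
  have z': "homologous_rel_set p (nsphere p) {} z \<in> carrier ?G"
    using reduced_cycle_class[OF z] .
  have "hom_induced (int p) (nsphere p) {} (nsphere p) {} f (homologous_rel_set p (nsphere p) {} z)
      = homologous_rel_set p (nsphere p) {} z [^]\<^bsub>?G\<^esub> Brouwer_degree2 p f"
    using Brouwer_degree2[OF z'] .
  \<comment> \<open>Reduced homology is a subgroup generated inside homology, so powers may be taken
    in the larger group.\<close>
  also have "\<dots> =
    homologous_rel_set p (nsphere p) {} z [^]\<^bsub>homology_group (int p) (nsphere p)\<^esub> Brouwer_degree2 p f"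
    unfolding reduced_homology_group_def
    by (metis group.int_pow_subgroup_generated group_relative_homology_group reduced_homology_group_def z')
  also have "\<dots> = homologous_rel_set p (nsphere p) {} (frag_cmul (Brouwer_degree2 p f) z)"
    by (rule int_pow_relative_homology_group[OF zc])
  finally show ?thesis
    using hom_induced_chain_map[OF f _ zc, of "{}"] by (simp add: homologous_rel_set_eq)
qed

text \<open>For degree \<open>2 e + 1\<close>, write \<open>z\<close> as
  \<open>(2 e + 1) z - 2 e z\<close>: the first term is homologous to the image of \<open>z\<close>,
  the second is a double.\<close>

lemma divisible2_odd_degree:
  assumes f: "continuous_map (nsphere p) (nsphere p) f" and z: "reduced_cycle p (nsphere p) z"
    and odd: "odd (Brouwer_degree2 p f)" and div: "divisible2 p (nsphere p) {} (chain_map p f z)"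
  shows "divisible2 p (nsphere p) {} z"
proof -
  obtain e where e: "Brouwer_degree2 p f = 2 * e + 1" using odd oddE by blast
  have "divisible2 p (nsphere p) {} (frag_cmul (2 * e + 1) z)"
    using div divisible2_cong[OF homologous_Brouwer_degree2[OF f z]] e by simp
  moreover have "divisible2 p (nsphere p) {} (frag_cmul (- 2 * e) z)"
    unfolding divisible2_def using z
    by (intro exI[of _ "frag_cmul (-e) z"]) (auto simp: reduced_cycle_def singular_relcycle_cmul)
  ultimately have "divisible2 p (nsphere p) {} (frag_cmul (2 * e + 1) z + frag_cmul (- 2 * e) z)"
    by (rule divisible2_add)
  then show ?thesis by (simp flip: frag_cmul_distrib)
qed

text \<open>The class is \<open>1 + s * Brouwer_degree2 p f\<close> times that of \<open>z\<close>,
  and this factor is even. Parity alone decides, so the sign of the cellular formula never has to be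
  compared with the degree of the action.\<close>

lemma divisible2_unit_degree:
  assumes f: "continuous_map (nsphere p) (nsphere p) f" and z: "reduced_cycle p (nsphere p) z"
    and deg: "odd (Brouwer_degree2 p f)" and s: "odd s"
  shows "divisible2 p (nsphere p) {} (z + frag_cmul s (chain_map p f z))"
proof -
  have "even (1 + s * Brouwer_degree2 p f)" using deg s by simp
  then obtain e where e: "1 + s * Brouwer_degree2 p f = 2 * e" by blast
  have *: "divisible2 p (nsphere p) {} (frag_cmul (1 + s * Brouwer_degree2 p f) z)"
    unfolding divisible2_def e using z
    by (intro exI[of _ "frag_cmul e z"]) (auto simp: reduced_cycle_def singular_relcycle_cmul)
  have "homologous_rel p (nsphere p) {} (frag_cmul s (chain_map p f z)) (frag_cmul s (frag_cmul (Brouwer_degree2 p f) z))"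
    using homologous_Brouwer_degree2[OF f z] by (rule homologous_rel_cmul)
  then have "homologous_rel p (nsphere p) {} (z + frag_cmul s (chain_map p f z))
      (z + frag_cmul s (frag_cmul (Brouwer_degree2 p f) z))"
    by (intro homologous_rel_add) auto
  moreover have "z + frag_cmul s (frag_cmul (Brouwer_degree2 p f) z) = frag_cmul (1 +
    s * Brouwer_degree2 p f) z"
    by (simp add: frag_cmul_distrib)
  ultimately show ?thesis using * divisible2_cong by metis
qed

section \<open>The cellular boundary formula and equivariant obstructions\<close>

text \<open>The dimension of the cell with index \<open>I\<close>. Since \<open>lower I j\<close>
  equals \<open>I\<close> when \<open>I j = 0\<close>, the walls are always taken under the guard
  \<open>0 < I j\<close>.\<close>

definition weight :: "nat \<Rightarrow> (nat \<Rightarrow> nat) \<Rightarrow> nat"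
  where "weight k I = (\<Sum>j<k. I j)"

abbreviation lower :: "(nat \<Rightarrow> nat) \<Rightarrow> nat \<Rightarrow> nat \<Rightarrow> nat"
  where "lower I j \<equiv> I(j := I j - 1)"

lemma weight_lower: "j < k \<Longrightarrow> 0 < I j \<Longrightarrow> Suc (weight k (lower I j)) = weight k I"
  unfolding weight_def by (simp add: sum.remove[of "{..<k}" j])

text \<open>
  The cellular boundary of a product of spheres with their standard \<open>\<int>/2\<close>-cell structures, one
  hemisphere pair in every dimension: the boundary of the upper \<open>i\<close>-hemisphere is \<open>e + (-1)\<^sup>i \<tau> e\<close>
  for the upper \<open>(i-1)\<close>-hemisphere \<open>e\<close>, and products contribute the usual Koszul signs. The
  index \<open>I\<close> lists the dimensions of the factors.
\<close>

definition cube_boundary ::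
    "nat \<Rightarrow> (nat \<Rightarrow> 'a \<Rightarrow> 'a) \<Rightarrow> nat \<Rightarrow> ((nat \<Rightarrow> nat) \<Rightarrow> 'a chain) \<Rightarrow> (nat \<Rightarrow> nat) \<Rightarrow> 'a chain"
  where "cube_boundary k \<tau> q a I =
    (\<Sum>j | j < k \<and> 0 < I j. frag_cmul ((-1) ^ (\<Sum>l<j. I l))
      (a (lower I j) + frag_cmul ((-1) ^ I j) (chain_map q (\<tau> j) (a (lower I j)))))"

lemma cube_boundary_cong:
  assumes "\<And>j. j < k \<Longrightarrow> 0 < I j \<Longrightarrow> a (lower I j) = b (lower I j)"
  shows "cube_boundary k \<tau> q a I = cube_boundary k \<tau> q b I"
  unfolding cube_boundary_def using assms by (intro sum.cong) auto

lemma cube_boundary_weight_0: "weight k I = 0 \<Longrightarrow> cube_boundary k \<tau> q a I = 0"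
  unfolding cube_boundary_def weight_def by (intro sum.neutral) auto

lemma cube_boundary_add:
  "cube_boundary k \<tau> q (\<lambda>J. a J + b J) I = cube_boundary k \<tau> q a I + cube_boundary k \<tau> q b I"
  unfolding cube_boundary_def
  by (simp add: chain_map_add frag_cmul_distrib2 add_ac flip: sum.distrib)

lemma cube_boundary_diff:
  "cube_boundary k \<tau> q (\<lambda>J. a J - b J) I = cube_boundary k \<tau> q a I - cube_boundary k \<tau> q b I"
  using cube_boundary_add[of k \<tau> q "\<lambda>J. a J - b J" b I] by simp

lemma singular_chain_cube_boundary:
  assumes "\<And>j. j < k \<Longrightarrow> 0 < I j \<Longrightarrow> singular_chain q X (a (lower I j))"
    and "\<And>j. j < k \<Longrightarrow> 0 < I j \<Longrightarrow> singular_chain q X (chain_map q (\<tau> j) (a (lower I j)))"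
  shows "singular_chain q X (cube_boundary k \<tau> q a I)"
  unfolding cube_boundary_def
  by (intro singular_chain_sum singular_chain_cmul singular_chain_add) (use assms in auto)

text \<open>Letting \<open>h\<close> change both the degree and the operators covers the boundary
  operator, which lowers \<open>q\<close>, as well as the chain map of an equivariant map, which
  replaces \<open>\<tau>\<close> by \<open>\<rho>\<close>.\<close>

lemma cube_boundary_natural:
  assumes add: "\<And>x y. h (x + y) = h x + h y"
    and cmul: "\<And>c x. h (frag_cmul c x) = frag_cmul c (h x)"
    and map: "\<And>j. j < k \<Longrightarrow> 0 < I j \<Longrightarrow>
      h (chain_map q (\<tau> j) (a (lower I j))) = chain_map q' (\<rho> j) (h (a (lower I j)))"
  shows "h (cube_boundary k \<tau> q a I) = cube_boundary k \<rho> q' (\<lambda>J. h (a J)) I"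
proof -
  have h0: "h 0 = 0" using cmul[of 0 0] by simp
  have hsum: "h (sum f A) = (\<Sum>i\<in>A. h (f i))" for f :: "nat \<Rightarrow> _" and A
    by (induction A rule: infinite_finite_induct) (auto simp: h0 add)
  show ?thesis
    unfolding cube_boundary_def hsum
      by (intro sum.cong refl) (auto simp: add cmul map[unfolded One_nat_def])
qed

section \<open>The cellular boundary squares to zero\<close>

lemma frag_eq_minus_self_imp_0:
  fixes x :: "'a chain"
  assumes "x = - x"
  shows "x = 0"
proof (rule poly_mapping_eqI)
  fix i
  have "Poly_Mapping.lookup x i = - Poly_Mapping.lookup x i"
    using assms by (metis lookup_uminus)
  then show "Poly_Mapping.lookup x i = Poly_Mapping.lookup 0 i" by simp
qed

text \<open>Exchanging the indices shows that the sum is its own negative, and chains have no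
  2-torsion; diagonal pairs are thereby included.\<close>

lemma sum_antisymmetric_0:
  fixes T :: "nat \<Rightarrow> nat \<Rightarrow> 'a chain"
  assumes sym: "prod.swap ` P = P" and anti: "\<And>j l. (j, l) \<in> P \<Longrightarrow> T l j = - T j l"
  shows "(\<Sum>(j, l)\<in>P. T j l) = 0"
proof (rule frag_eq_minus_self_imp_0)
  have "(\<Sum>(j, l)\<in>P. T j l) = (\<Sum>(j, l)\<in>prod.swap ` P. T j l)" by (simp only: sym)
  also have "\<dots> = (\<Sum>(j, l)\<in>P. T l j)"
    by (subst sum.reindex) (auto simp: case_prod_unfold)
  also have "\<dots> = (\<Sum>(j, l)\<in>P. - T j l)" by (intro sum.cong) (auto simp: anti)
  finally show "(\<Sum>(j, l)\<in>P. T j l) = - (\<Sum>(j, l)\<in>P. T j l)"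
    by (simp add: sum_negf case_prod_unfold)
qed

text \<open>For \<open>j \<noteq> l\<close> the two orders of lowering give the same terms with
  opposite signs. For \<open>j = l\<close> the second lowering has sign \<open>-e\<close> if the
  first has \<open>e\<close>, and \<open>(1 + e t) (1 - e t) = 1 - t t = 0\<close> for the
  involution \<open>t\<close>.\<close>

lemma cube_boundary_cube_boundary:
  assumes chain: "\<And>j l. j < k \<Longrightarrow> 0 < I j \<Longrightarrow> l < k \<Longrightarrow> 0 < lower I j l \<Longrightarrow>
      singular_chain q Y (a (lower (lower I j) l))"
    and comm: "\<And>j l x. j < k \<Longrightarrow> l < k \<Longrightarrow> x \<in> topspace Y \<Longrightarrow> \<tau> j (\<tau> l x) = \<tau> l (\<tau> j x)"
    and inv: "\<And>j x. j < k \<Longrightarrow> x \<in> topspace Y \<Longrightarrow> \<tau> j (\<tau> j x) = x"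
  shows "cube_boundary k \<tau> q (cube_boundary k \<tau> q a) I = 0"
proof -
  let ?t = "\<lambda>j. chain_map q (\<tau> j)"
  have t_comp: "?t j (?t l x) = chain_map q (\<tau> j \<circ> \<tau> l) x" for j l x
    by (simp add: chain_map_compose)
  have t_comm: "?t j (?t l x) = ?t l (?t j x)" if "j < k" "l < k" "singular_chain q Y x" for j l x
    unfolding t_comp using that comm by (intro chain_map_eq) auto
  have t_inv: "?t j (?t j x) = x" if "j < k" "singular_chain q Y x" for j x
    unfolding t_comp using that inv by (intro chain_map_id_gen) auto
  define s where "s I j = ((-1) ^ (\<Sum>l<j. I l) :: int)" for I and j :: nat
  define T where "T j l = frag_cmul (s I j * s (lower I j) l)
     (let y = a (lower (lower I j) l); e = (-1) ^ I j; e' = (-1) ^ lower I j l in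
      y + frag_cmul e (?t j y) + frag_cmul e' (?t l y) + frag_cmul (e * e') (?t j (?t l y)))" for j l
  define A where "A = {j. j < k \<and> 0 < I j}"
  define B where "B j = {l. l < k \<and> 0 < lower I j l}" for j
  have "cube_boundary k \<tau> q (cube_boundary k \<tau> q a) I = (\<Sum>j\<in>A. \<Sum>l\<in>B j. T j l)"
    unfolding cube_boundary_def[of k \<tau> q _ I] A_def[symmetric]
  proof (intro sum.cong refl)
    fix j
    assume "j \<in> A"
    let ?h = "\<lambda>x. frag_cmul (s I j) (x + frag_cmul ((-1) ^ I j) (?t j x))"
    have h0: "?h 0 = 0" by simp
    have hadd: "?h (x + y) = ?h x + ?h y" for x y
      by (simp add: chain_map_add frag_cmul_distrib2 add_ac)
    have hsum: "?h (sum f C) = (\<Sum>i\<in>C. ?h (f i))" for f :: "nat \<Rightarrow> _" and C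
      by (induction C rule: infinite_finite_induct) (simp_all add: h0 hadd del: frag_cmul_cmul)
    have "frag_cmul ((- 1) ^ sum I {..<j}) (cube_boundary k \<tau> q a (lower I j) +
        frag_cmul ((- 1) ^ I j) (?t j (cube_boundary k \<tau> q a (lower I j))))
      = ?h (cube_boundary k \<tau> q a (lower I j))" by (simp add: s_def)
    also have "\<dots> = (\<Sum>l\<in>B j. T j l)"
      unfolding cube_boundary_def[of k \<tau> q a "lower I j"] hsum B_def[symmetric]
      by (intro sum.cong refl)
        (simp add: T_def s_def Let_def chain_map_add frag_cmul_distrib2 ac_simps)
    finally show "frag_cmul ((- 1) ^ sum I {..<j}) (cube_boundary k \<tau> q a (lower I j) +
        frag_cmul ((- 1) ^ I j) (?t j (cube_boundary k \<tau> q a (lower I j)))) = (\<Sum>l\<in>B j. T j l)" .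
  qed
  also have "\<dots> = (\<Sum>(j, l)\<in>Sigma A B. T j l)"
    by (intro sum.Sigma) (auto simp: A_def B_def)
  also have "\<dots> = 0"
  proof (rule sum_antisymmetric_0)
    \<comment> \<open>The index set is symmetric: for different indices both entries of
      \<open>I\<close> are positive, and for equal ones the entry is at least 2.\<close>
    have sub: "prod.swap ` Sigma A B \<subseteq> Sigma A B"
      by (auto simp: A_def B_def split: if_splits)
    then have "prod.swap ` (prod.swap ` Sigma A B) \<subseteq> prod.swap ` Sigma A B" by (rule image_mono)
    then show "prod.swap ` Sigma A B = Sigma A B" using sub by (simp add: image_image)
    fix j l
    assume "(j, l) \<in> Sigma A B"
    then have jl: "j < k" "0 < I j" "l < k" "0 < lower I j l" by (auto simp: A_def B_def)
    have y: "singular_chain q Y (a (lower (lower I j) l))" using chain[OF jl] .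
    show "T l j = - T j l"
    proof (cases "j = l")
      case True
      have "(-1) ^ I l = - ((-1 :: int) ^ (I l - 1))"
        using jl True by (cases "I l") auto
      moreover have "(-1 :: int) ^ m * (-1) ^ m = 1" for m
        by (simp flip: power_mult_distrib)
      ultimately have "T l l = 0"
        using t_inv[OF jl(3) y] True
        by (intro poly_mapping_eqI) (simp add: T_def Let_def lookup_add)
      then show ?thesis using True by simp
    next
      case False
      \<comment> \<open>Lowering the earlier entry \<open>v\<close> shortens the sum behind the sign
        of \<open>w\<close> by one, while lowering \<open>w\<close> leaves the sign of
        \<open>v\<close> alone; so exactly one sign changes.\<close>
      have sgn: "s I v * s (lower I v) w = - (s I w * s (lower I w) v)"
        if "v < w" "0 < I v" for v w
      proof -
        have "(\<Sum>i<v. lower I w i) = (\<Sum>i<v. I i)" using that by (intro sum.cong) auto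
        moreover have "Suc (\<Sum>i<w. lower I v i) = (\<Sum>i<w. I i)"
          using weight_lower[of v w I] that unfolding weight_def by simp
        ultimately show ?thesis
          unfolding s_def by (simp flip: \<open>Suc _ = _\<close>)
      qed
      have "s I j * s (lower I j) l = - (s I l * s (lower I l) j)"
      proof (cases "j < l")
        case True
        then show ?thesis using sgn jl by blast
      next
        case c: False
        then show ?thesis using sgn[of l j] jl False by (simp split: if_splits)
      qed
      moreover have "lower (lower I j) l = lower (lower I l) j"
        using False by (simp add: fun_upd_twist)
      ultimately show ?thesis
        using False t_comm[OF jl(1,3) y] by (simp add: T_def Let_def algebra_simps)
    qed
  qed
  finally show ?thesis .
qed

text \<open>
  The lower skeleton carries no obstruction, since the sphere is acyclic below dimension \<open>M\<close>: the
  chains \<open>T I\<close> below form an equivariant chain homotopy from \<open>d\<close> to \<open>0\<close>. In dimension \<open>M\<close> it fails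
  to be one by cycles \<open>w\<close>, and these enter only through \<open>w \<plusminus> \<rho> w\<close>, which is an even class because
  \<open>\<rho>\<close> has degree \<open>\<plusminus>1\<close>.
\<close>

lemma equivariant_family_divisible2:
  fixes \<rho> :: "nat \<Rightarrow> (nat \<Rightarrow> real) \<Rightarrow> nat \<Rightarrow> real"
  assumes B: "weight k B = Suc M"
    and chain: "\<And>I. (\<And>j. j < k \<Longrightarrow> I j \<le> B j) \<Longrightarrow> weight k I \<le> M \<Longrightarrow>
      singular_chain (weight k I) (nsphere M) (d I)"
    and bd: "\<And>I. (\<And>j. j < k \<Longrightarrow> I j \<le> B j) \<Longrightarrow> weight k I \<le> M \<Longrightarrow> 0 < weight k I \<Longrightarrow>
      chain_boundary (weight k I) (d I) = cube_boundary k \<rho> (weight k I - 1) d I"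
    and red: "\<And>I. (\<And>j. j < k \<Longrightarrow> I j \<le> B j) \<Longrightarrow> weight k I = 0 \<Longrightarrow> chain_map 0 (\<lambda>_. ()) (d I) = 0"
    and cont: "\<And>j. j < k \<Longrightarrow> continuous_map (nsphere M) (nsphere M) (\<rho> j)"
    and comm: "\<And>j l x. j < k \<Longrightarrow> l < k \<Longrightarrow> x \<in> topspace (nsphere M) \<Longrightarrow> \<rho> j (\<rho> l x) = \<rho> l (\<rho> j x)"
    and inv: "\<And>j x. j < k \<Longrightarrow> x \<in> topspace (nsphere M) \<Longrightarrow> \<rho> j (\<rho> j x) = x"
  shows "divisible2 M (nsphere M) {} (cube_boundary k \<rho> M d B)"
proof -
  define le where "le I \<longleftrightarrow> (\<forall>j<k. I j \<le> B j)" for I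
  have le_lower: "le (lower I j)" if "le I" for I j
    using that unfolding le_def by (auto intro: diff_le_mono2 le_trans)
  \<comment> \<open>This is the homotopy equation, with boundary of \<open>T\<close> plus
    \<open>T\<close> of the boundary equal to \<open>d\<close>. It is demanded only below dimension
    \<open>M\<close>, where the sphere is acyclic.\<close>
  define good where "good T I x \<longleftrightarrow> (le I \<and> weight k I < M \<longrightarrow>
      singular_chain (Suc (weight k I)) (nsphere M) x \<and>
      chain_boundary (Suc (weight k I)) x = d I - cube_boundary k \<rho> (weight k I) T I)" for T I x
  have T_chain: "singular_chain (weight k I) (nsphere M) (T (lower I j))"
    if le: "le I" "weight k I \<le> M" and T: "\<And>J. weight k J < weight k I \<Longrightarrow> good T J (T J)"
      and j: "j < k" "0 < I j" for I T j
    using T[of "lower I j"] le_lower[OF le(1)] weight_lower[of j k I] j le unfolding good_def by auto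
  \<comment> \<open>The boundary of \<open>d - T\<partial>\<close> is \<open>d\<partial> - (d -
    T\<partial>)\<partial> = T\<partial>\<partial> = 0\<close>, using the homotopy equation on the
    walls of \<open>I\<close>.\<close>
  have cycle: "reduced_cycle (weight k I) (nsphere M) (d I - cube_boundary k \<rho> (weight k I) T I)"
    if le: "le I" "weight k I \<le> M" and T: "\<And>J. weight k J < weight k I \<Longrightarrow> good T J (T J)" for I T
  proof (cases "weight k I")
    case 0
    then show ?thesis
      using chain[of I] red[of I] le
      by (simp add: cube_boundary_weight_0 reduced_cycle_def singular_cycle chain_boundary_def le_def)
  next
    case (Suc w)
    have "singular_chain (weight k I) (nsphere M) (cube_boundary k \<rho> (weight k I) T I)"
      using T_chain[OF le T] cont
        by (intro singular_chain_cube_boundary singular_chain_chain_map) auto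
    moreover have "chain_boundary (weight k I) (cube_boundary k \<rho> (weight k I) T I)
      = cube_boundary k \<rho> w (\<lambda>J. chain_boundary (weight k I) (T J)) I"
      using chain_boundary_chain_map[OF T_chain[OF le T]] Suc
      by (intro cube_boundary_natural) (auto simp: chain_boundary_add chain_boundary_cmul)
    moreover have "\<dots> = cube_boundary k \<rho> w (\<lambda>J. d J - cube_boundary k \<rho> w T J) I"
    proof (rule cube_boundary_cong)
      fix j assume j: "j < k" "0 < I j"
      then have w: "weight k (lower I j) = w" using weight_lower[of j k I, OF j] Suc by simp
      then show "chain_boundary (weight k I) (T (lower I j)) =
        d (lower I j) - cube_boundary k \<rho> w T (lower I j)"
        using T[of "lower I j"] Suc le le_lower[OF le(1)] unfolding good_def by auto
    qed
    moreover have "\<dots> = cube_boundary k \<rho> w d I"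
    proof -
      have "cube_boundary k \<rho> w (cube_boundary k \<rho> w T) I = 0"
      proof (rule cube_boundary_cube_boundary[where Y = "nsphere M"])
        fix j l
        assume jl: "j < k" "0 < I j" "l < k" "0 < lower I j l"
        have w: "weight k (lower I j) = w" using weight_lower[of j k I, OF jl(1,2)] Suc by simp
        have "singular_chain (weight k (lower I j)) (nsphere M) (T (lower (lower I j) l))"
          by (rule T_chain[of "lower I j" T, OF le_lower[OF le(1)] _ _ jl(3,4)]) (use T w Suc le(2) in auto)
        then show "singular_chain w (nsphere M) (T (lower (lower I j) l))"
          unfolding w .
      qed (use comm inv in auto)
      then show ?thesis by (simp add: cube_boundary_diff)
    qed
    ultimately show ?thesis
      using chain[of I] bd[of I] le Suc
      by (simp add: reduced_cycle_def singular_cycle singular_chain_diff chain_boundary_diff le_def)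
  qed
  \<comment> \<open>Recursion on the dimension of the cell: the condition on \<open>T I\<close>
    refers to \<open>T\<close> only on the walls of \<open>I\<close>.\<close>
  have "\<exists>T. \<forall>I. good T I (T I)"
  proof (rule dependent_wf_choice[OF wf_measure[of "weight k"]])
    fix f g :: "(nat \<Rightarrow> nat) \<Rightarrow> (nat \<Rightarrow> real) chain" and I r
    assume eq: "\<And>J. (J, I) \<in> measure (weight k) \<Longrightarrow> f J = g J"
    have "cube_boundary k \<rho> (weight k I) f I = cube_boundary k \<rho> (weight k I) g I"
    proof (rule cube_boundary_cong)
      fix j assume j: "j < k" "0 < I j"
      show "f (lower I j) = g (lower I j)"
        using weight_lower[of j k I, OF j] by (intro eq) simp
    qed
    then show "good f I r = good g I r" by (simp add: good_def)
  next
    fix I T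
    assume "\<And>J. (J, I) \<in> measure (weight k) \<Longrightarrow> good T J (T J)"
    then have T: "\<And>J. weight k J < weight k I \<Longrightarrow> good T J (T J)" by simp
    show "\<exists>r. good T I r"
    proof (cases "le I \<and> weight k I < M")
      case True
      then have "reduced_cycle (weight k I) (nsphere M) (d I - cube_boundary k \<rho> (weight k I) T I)"
        using cycle T by simp
      moreover have "trivial_group (reduced_homology_group (int (weight k I)) (nsphere M))"
        using True by (simp add: trivial_reduced_homology_group_nsphere)
      ultimately show ?thesis
        using reduced_cycle_boundary unfolding good_def by metis
    qed (auto simp: good_def)
  qed
  then obtain T where T: "\<And>I. good T I (T I)" by blast
  define w where "w I = d I - cube_boundary k \<rho> M T I" for I
  have leB: "le B" by (simp add: le_def)
  have wB: "reduced_cycle M (nsphere M) (w (lower B j))" "weight k (lower B j) = M"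
    if "j < k" "0 < B j" for j
  proof -
    show 1: "weight k (lower B j) = M" using weight_lower[of j k B, OF that] B by simp
    show "reduced_cycle M (nsphere M) (w (lower B j))"
      using cycle[OF le_lower[OF leB, of j], of T] T 1 by (simp add: w_def)
  qed
  have "cube_boundary k \<rho> M d B = cube_boundary k \<rho> M (\<lambda>J. w J + cube_boundary k \<rho> M T J) B"
    by (simp add: w_def)
  also have "\<dots> = cube_boundary k \<rho> M w B + cube_boundary k \<rho> M (cube_boundary k \<rho> M T) B"
    by (simp add: cube_boundary_add)
  also have "cube_boundary k \<rho> M (cube_boundary k \<rho> M T) B = 0"
  proof (rule cube_boundary_cube_boundary[where Y = "nsphere M"])
    fix j l
    assume jl: "j < k" "0 < B j" "l < k" "0 < lower B j l"
    show "singular_chain M (nsphere M) (T (lower (lower B j) l))"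
      using T_chain[of "lower B j" T, OF le_lower[OF leB] _ T jl(3,4)] wB(2)[OF jl(1,2)] by simp
  qed (use comm inv in auto)
  finally have "cube_boundary k \<rho> M d B = cube_boundary k \<rho> M w B" by simp
  moreover have "divisible2 M (nsphere M) {} (cube_boundary k \<rho> M w B)"
    unfolding cube_boundary_def
  proof (intro divisible2_sum divisible2_cmul)
    fix j
    assume "j \<in> {j. j < k \<and> 0 < B j}"
    then have j: "j < k" "0 < B j" by auto
    have "homeomorphic_maps (nsphere M) (nsphere M) (\<rho> j) (\<rho> j)"
      using cont[OF j(1)] inv[OF j(1)] by (simp add: homeomorphic_maps_def)
    then have "\<bar>Brouwer_degree2 M (\<rho> j)\<bar> = 1" by (rule Brouwer_degree2_homeomorphic_maps)
    then have "odd (Brouwer_degree2 M (\<rho> j))"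
      by (metis even_abs_add_iff even_zero odd_one add.right_neutral)
    then show "divisible2 M (nsphere M) {} (w (lower B j) +
        frag_cmul ((- 1) ^ B j) (chain_map M (\<rho> j) (w (lower B j))))"
      using wB(1)[OF j] cont[OF j(1)] by (intro divisible2_unit_degree) auto
  qed
  ultimately show ?thesis by simp
qed

section \<open>Products of hemispheres\<close>

text \<open>One ambient space for cells of all dimensions, their boundaries and the sphere products,
  so that inclusions between them are just inclusions of subsets.\<close>

definition tuples :: "nat \<Rightarrow> (nat \<Rightarrow> nat \<Rightarrow> real) topology"
  where "tuples k = product_topology (\<lambda>_. powertop_real UNIV) {..<k}"

lemma topspace_tuples: "topspace (tuples k) = extensional {..<k}"
  by (auto simp: tuples_def PiE_def)

lemma continuous_map_into_tuples:
  "continuous_map Z (tuples k) f \<longleftrightarrow> f \<in> topspace Z \<rightarrow> extensional {..<k} \<and>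
    (\<forall>j<k. \<forall>i. continuous_map Z euclideanreal (\<lambda>z. f z j i))"
  unfolding tuples_def continuous_map_componentwise continuous_map_componentwise_UNIV by auto

lemma continuous_map_tuples_coordinate:
  "j < k \<Longrightarrow> continuous_map (subtopology (tuples k) S) euclideanreal (\<lambda>x. x j i)"
  using continuous_map_into_tuples[of "tuples k" k id]
  by (auto intro: continuous_map_from_subtopology)

text \<open>Hemispheres are nested through vanishing coordinates: the one of dimension
  \<open>I j - 1\<close> is a half of the equator of the one of dimension
  \<open>I j\<close>.\<close>

definition cell :: "nat \<Rightarrow> (nat \<Rightarrow> nat) \<Rightarrow> (nat \<Rightarrow> nat \<Rightarrow> real) set"
  where "cell k I = {x \<in> extensional {..<k}. \<forall>j<k. (\<forall>i>I j. x j i = 0) \<and>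
    (\<Sum>i\<le>I j. (x j i)\<^sup>2) = 1 \<and> 0 \<le> x j (I j)}"

definition cell_bd :: "nat \<Rightarrow> (nat \<Rightarrow> nat) \<Rightarrow> (nat \<Rightarrow> nat \<Rightarrow> real) set"
  where "cell_bd k I = {x \<in> cell k I. \<exists>j<k. x j (I j) = 0}"

text \<open>The centre of the cell: it corresponds to the origin of the product of discs, and the
  cell without it retracts to \<open>cell_bd\<close>.\<close>

definition pole :: "nat \<Rightarrow> (nat \<Rightarrow> nat) \<Rightarrow> nat \<Rightarrow> nat \<Rightarrow> real"
  where "pole k I = (\<lambda>j\<in>{..<k}. \<lambda>i. if i = I j then 1 else 0)"

text \<open>The inverse of the projection of a product of hemispheres onto a product of discs.\<close>

definition lift :: "nat \<Rightarrow> (nat \<Rightarrow> nat) \<Rightarrow> (nat \<Rightarrow> nat \<Rightarrow> real) \<Rightarrow> nat \<Rightarrow> nat \<Rightarrow> real"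
  where "lift k I u = (\<lambda>j\<in>{..<k}. \<lambda>i. if i < I j then u j i
    else if i = I j then sqrt (1 - (\<Sum>i<I j. (u j i)\<^sup>2)) else 0)"

lemma sum_atMost_eq: "(\<Sum>i\<le>(n::nat). f i) = (\<Sum>i<n. f i) + (f n :: real)"
  by (simp flip: lessThan_Suc_atMost)

lemma cell_extensional: "cell k I \<subseteq> topspace (tuples k)"
  by (auto simp: topspace_tuples cell_def)

lemma cell_bd_subset: "cell_bd k I \<subseteq> cell k I"
  by (auto simp: cell_bd_def)

lemma pole_in_cell: "pole k I \<in> cell k I"
proof -
  have "(\<Sum>i\<le>I j. (if i = I j then 1 else 0 :: real)\<^sup>2) = 1" for j
    by (simp add: if_distrib[of "\<lambda>x. x\<^sup>2"] cong: if_cong)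
  then show ?thesis by (simp add: pole_def cell_def)
qed

lemma pole_notin_cell_bd: "pole k I \<notin> cell_bd k I"
  by (auto simp: pole_def cell_bd_def)

lemma lift_in_cell:
  assumes "\<And>j. j < k \<Longrightarrow> (\<Sum>i<I j. (u j i)\<^sup>2) \<le> 1"
  shows "lift k I u \<in> cell k I"
proof -
  have "(\<Sum>i\<le>I j. (lift k I u j i)\<^sup>2) = 1" if "j < k" for j
    unfolding sum_atMost_eq using assms[OF that] that by (simp add: lift_def)
  then show ?thesis using assms by (simp add: cell_def) (simp add: lift_def)
qed

lemma cell_last_coordinate:
  assumes "x \<in> cell k I" "j < k"
  shows "x j (I j) = sqrt (1 - (\<Sum>i<I j. (x j i)\<^sup>2))"
proof -
  have "(x j (I j))\<^sup>2 = 1 - (\<Sum>i<I j. (x j i)\<^sup>2)" "0 \<le> x j (I j)"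
    using assms by (simp_all add: cell_def sum_atMost_eq algebra_simps)
  then show ?thesis by (metis real_sqrt_unique)
qed

lemma cell_block_le_1:
  assumes "x \<in> cell k I" "j < k"
  shows "(\<Sum>i<I j. (x j i)\<^sup>2) \<le> 1"
proof -
  have "(\<Sum>i<I j. (x j i)\<^sup>2) + (x j (I j))\<^sup>2 = 1"
    using assms by (simp add: cell_def sum_atMost_eq)
  then show ?thesis using zero_le_power2[of "x j (I j)"] by linarith
qed

lemma lift_cell: "x \<in> cell k I \<Longrightarrow> lift k I x = x"
proof (rule ext)
  fix j assume x: "x \<in> cell k I"
  show "lift k I x j = x j"
  proof (cases "j < k")
    case True
    have "x j i = 0" if "i > I j" for i using x True that by (simp add: cell_def)
    then show ?thesis
      using True cell_last_coordinate[OF x True] by (auto simp: lift_def fun_eq_iff)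
  next
    case False
    then show ?thesis using x by (simp add: lift_def cell_def extensional_def)
  qed
qed

lemma lift_cong:
  assumes "\<And>j i. j < k \<Longrightarrow> i < I j \<Longrightarrow> u j i = v j i"
  shows "lift k I u = lift k I v"
  using assms by (auto simp: lift_def fun_eq_iff intro!: sum.cong)

text \<open>The total function \<open>sqrt\<close> is continuous on the whole real line, so points
  outside the product of discs cause no exception.\<close>

lemma continuous_map_lift:
  assumes "\<And>j i. j < k \<Longrightarrow> i < I j \<Longrightarrow> continuous_map Z euclideanreal (\<lambda>z. u z j i)"
  shows "continuous_map Z (tuples k) (\<lambda>z. lift k I (u z))"
  unfolding continuous_map_into_tuples
proof (intro conjI allI impI)
  fix j i assume "j < k"
  then show "continuous_map Z euclideanreal (\<lambda>z. lift k I (u z) j i)"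
    unfolding lift_def
    by (cases "i < I j"; cases "i = I j") (auto intro!: continuous_intros assms)
qed (simp add: lift_def)

text \<open>The cell is a graph over a product of discs; scaling the disc coordinates to 0 and
  lifting contracts it to the pole.\<close>

lemma contractible_cell: "contractible_space (subtopology (tuples k) (cell k I))"
proof -
  let ?X = "subtopology (tuples k) (cell k I)"
  let ?h = "\<lambda>z. lift k I (\<lambda>j i. (1 - fst z) * snd z j i)"
  have "homotopic_with (\<lambda>x. True) ?X ?X id (\<lambda>x. lift k I (\<lambda>j i. 0))"
  proof (subst homotopic_with, simp, intro exI[of _ ?h] conjI ballI)
    have "continuous_map (prod_topology (top_of_set {0..1}) ?X) (tuples k) ?h"
    proof (rule continuous_map_lift)
      fix j i assume "j < k"
      then have "continuous_map (prod_topology (top_of_set {0..1}) ?X) euclideanreal ((\<lambda>x. x j i) \<circ> snd)"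
        by (intro continuous_map_compose[OF continuous_map_snd] continuous_map_tuples_coordinate)
      moreover have "continuous_map (prod_topology (top_of_set {0..1}) ?X) euclideanreal fst"
        using continuous_map_fst continuous_map_into_fulltopology by blast
      ultimately show "continuous_map (prod_topology (top_of_set {0..1}) ?X) euclideanreal
          (\<lambda>z. (1 - fst z) * snd z j i)"
        by (intro continuous_intros) (simp_all add: o_def)
    qed
    moreover have "lift k I (\<lambda>j i. (1 - t) * x j i) \<in> cell k I"
      if "0 \<le> t" "t \<le> 1" "x \<in> cell k I" for t :: real and x
    proof (rule lift_in_cell)
      fix j assume j: "j < k"
      have "(\<Sum>i<I j. ((1 - t) * x j i)\<^sup>2) = (1 - t)\<^sup>2 * (\<Sum>i<I j. (x j i)\<^sup>2)"
        by (simp add: power_mult_distrib sum_distrib_left)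
      also have "\<dots> \<le> 1 * 1"
        using that cell_block_le_1[OF that(3) j]
        by (intro mult_mono power_le_one) (auto intro: sum_nonneg)
      finally show "(\<Sum>i<I j. ((1 - t) * x j i)\<^sup>2) \<le> 1" by simp
    qed
    ultimately show "continuous_map (prod_topology (top_of_set {0..1}) ?X) ?X ?h"
      by (auto simp: continuous_map_in_subtopology)
  qed (auto simp: lift_cell)
  then show ?thesis unfolding contractible_space_def by blast
qed

section \<open>The gauge of a product of discs and the radial projection\<close>

text \<open>The norm on the disc coordinates whose unit ball is the product of discs; on the
  boundary of the cell it has the value 1.\<close>

primrec block_norm :: "(nat \<Rightarrow> nat) \<Rightarrow> (nat \<Rightarrow> nat \<Rightarrow> real) \<Rightarrow> nat \<Rightarrow> real"
  where "block_norm I u 0 = 0"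
  | "block_norm I u (Suc k) = max (block_norm I u k) (sqrt (\<Sum>i<I k. (u k i)\<^sup>2))"

lemma block_le_block_norm: "j < k \<Longrightarrow> sqrt (\<Sum>i<I j. (u j i)\<^sup>2) \<le> block_norm I u k"
  by (induction k) (auto simp: less_Suc_eq)

lemma block_norm_le_iff:
  "0 \<le> c \<Longrightarrow> block_norm I u k \<le> c \<longleftrightarrow> (\<forall>j<k. sqrt (\<Sum>i<I j. (u j i)\<^sup>2) \<le> c)"
  by (induction k) (auto simp: less_Suc_eq)

lemma block_norm_attained:
  "0 < block_norm I u k \<Longrightarrow> \<exists>j<k. sqrt (\<Sum>i<I j. (u j i)\<^sup>2) = block_norm I u k"
proof (induction k)
  case (Suc k)
  then show ?case
    by (cases "block_norm I u k \<le> sqrt (\<Sum>i<I k. (u k i)\<^sup>2)") (auto simp: max_def less_Suc_eq)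
qed simp

lemma block_norm_scale: "0 \<le> c \<Longrightarrow> block_norm I (\<lambda>j i. u j i * c) k = block_norm I u k * c"
proof (induction k)
  case (Suc k)
  have "(\<Sum>i<I k. (u k i * c)\<^sup>2) = (\<Sum>i<I k. (u k i)\<^sup>2) * c\<^sup>2"
    by (simp add: power_mult_distrib sum_distrib_right)
  then show ?case using Suc by (simp add: real_sqrt_mult max_mult_distrib_right)
qed simp

lemma block_norm_pos:
  assumes "j < k" "i < I j" "u j i \<noteq> 0"
  shows "0 < block_norm I u k"
proof -
  have "0 < (\<Sum>i<I j. (u j i)\<^sup>2)"
    using assms by (intro sum_pos2[of _ i]) auto
  then have "0 < sqrt (\<Sum>i<I j. (u j i)\<^sup>2)" by simp
  then show ?thesis using block_le_block_norm[OF assms(1)] by (rule less_le_trans)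
qed

lemma continuous_map_block_norm:
  assumes "\<And>j i. j < k \<Longrightarrow> i < I j \<Longrightarrow> continuous_map Z euclideanreal (\<lambda>z. u z j i)"
  shows "continuous_map Z euclideanreal (\<lambda>z. block_norm I (u z) k)"
  using assms by (induction k) (auto intro!: continuous_intros)

text \<open>Projection from the pole to the boundary of the cell. It serves as the retraction of the
  punctured cell and, on concatenated coordinates, as a homeomorphism from a round sphere.\<close>

definition radial :: "nat \<Rightarrow> (nat \<Rightarrow> nat) \<Rightarrow> (nat \<Rightarrow> nat \<Rightarrow> real) \<Rightarrow> nat \<Rightarrow> nat \<Rightarrow> real"
  where "radial k I u = lift k I (\<lambda>j i. u j i / block_norm I u k)"

text \<open>A block that attains the maximum acquires norm 1, and \<open>lift\<close> then gives it
  the last coordinate 0.\<close>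

lemma radial_in_cell_bd:
  assumes "0 < block_norm I u k"
  shows "radial k I u \<in> cell_bd k I"
proof -
  let ?M = "block_norm I u k"
  have sq: "(\<Sum>i<I j. (u j i / ?M)\<^sup>2) = ((sqrt (\<Sum>i<I j. (u j i)\<^sup>2)) / ?M)\<^sup>2" for j
    by (simp add: power_divide sum_divide_distrib sum_nonneg)
  have "(\<Sum>i<I j. (u j i / ?M)\<^sup>2) \<le> 1" if "j < k" for j
    unfolding sq using block_le_block_norm[OF that, of u I] assms
    by (intro power_le_one) (auto simp: divide_le_eq sum_nonneg)
  moreover obtain j where "j < k" "sqrt (\<Sum>i<I j. (u j i)\<^sup>2) = ?M"
    using block_norm_attained[OF assms] by blast
  moreover from this have "(\<Sum>i<I j. (u j i / ?M)\<^sup>2) = 1"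
    unfolding sq using assms by simp
  ultimately show ?thesis
    unfolding radial_def cell_bd_def using lift_in_cell[of k "\<lambda>j i. u j i / ?M" I]
    by (auto intro!: exI[of _ j] simp: lift_def)
qed

lemma block_norm_cell_bd:
  assumes "x \<in> cell_bd k I"
  shows "block_norm I x k = 1"
proof (rule antisym)
  have x: "x \<in> cell k I" using assms by (simp add: cell_bd_def)
  show "block_norm I x k \<le> 1"
    using cell_block_le_1[OF x] by (simp add: block_norm_le_iff)
  obtain j where j: "j < k" "x j (I j) = 0" using assms by (auto simp: cell_bd_def)
  then have "(\<Sum>i<I j. (x j i)\<^sup>2) = 1"
    using x by (auto simp: cell_def sum_atMost_eq)
  then show "1 \<le> block_norm I x k" using block_le_block_norm[OF j(1), of x I] by simp
qed

lemma radial_cell_bd: "x \<in> cell_bd k I \<Longrightarrow> radial k I x = x"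
  by (simp add: radial_def block_norm_cell_bd lift_cell cell_bd_def)

lemma block_norm_pos_cell:
  assumes "x \<in> cell k I" "x \<noteq> pole k I"
  shows "0 < block_norm I x k"
proof (rule ccontr)
  assume "\<not> 0 < block_norm I x k"
  then have "x j i = 0" if "j < k" "i < I j" for j i
    using block_norm_pos[of j k i I x] that by blast
  then have "lift k I x = lift k I (\<lambda>j i. 0)" by (intro lift_cong) auto
  also have "\<dots> = pole k I" by (auto simp: lift_def pole_def fun_eq_iff)
  finally show False using assms by (simp add: lift_cell)
qed

lemma continuous_map_radial:
  assumes "\<And>j i. j < k \<Longrightarrow> i < I j \<Longrightarrow> continuous_map Z euclideanreal (\<lambda>z. u z j i)"
    and "\<And>z. z \<in> topspace Z \<Longrightarrow> 0 < block_norm I (u z) k"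
  shows "continuous_map Z (subtopology (tuples k) (cell_bd k I)) (\<lambda>z. radial k I (u z))"
proof -
  have "continuous_map Z (tuples k) (\<lambda>z. radial k I (u z))"
    unfolding radial_def
    by (intro continuous_map_lift continuous_intros continuous_map_block_norm assms)
      (use assms(2) in fastforce)+
  then show ?thesis
    using radial_in_cell_bd assms(2) by (auto simp: continuous_map_in_subtopology)
qed

section \<open>Flips and the walls of a cell\<close>

abbreviation flip :: "nat \<Rightarrow> nat \<Rightarrow> (nat \<Rightarrow> nat \<Rightarrow> real) \<Rightarrow> nat \<Rightarrow> nat \<Rightarrow> real"
  where "flip k j \<equiv> tuple_action k (Z2gen j)"

lemma flip_apply: "i < k \<Longrightarrow> flip k j x i = (if i = j then (\<lambda>l. - x j l) else x i)"
  by (simp add: tuple_action_def Z2gen_def)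

lemma flip_extensional: "flip k j x \<in> extensional {..<k}"
  by (simp add: tuple_action_def)

lemma flip_commute: "flip k j (flip k l x) = flip k l (flip k j x)"
  by (auto simp: tuple_action_def Z2gen_def restrict_def fun_eq_iff)

lemma flip_flip: "x \<in> extensional {..<k} \<Longrightarrow> flip k j (flip k j x) = x"
  by (auto simp: tuple_action_def Z2gen_def restrict_def fun_eq_iff extensional_def)

lemma continuous_map_flip: "continuous_map (subtopology (tuples k) S) (tuples k) (flip k j)"
  unfolding continuous_map_into_tuples
proof (intro conjI allI impI)
  fix i l assume "i < k"
  then show "continuous_map (subtopology (tuples k) S) euclideanreal (\<lambda>x. flip k j x i l)"
    by (cases "i =
      j") (auto simp: flip_apply intro!: continuous_intros continuous_map_tuples_coordinate)
qed (simp add: flip_extensional)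

lemma cell_lower_last: "x \<in> cell k (lower I j) \<Longrightarrow> j < k \<Longrightarrow> 0 < I j \<Longrightarrow> x j (I j) = 0"
  by (simp add: cell_def)

lemma cell_lower_subset:
  assumes "j < k" "0 < I j"
  shows "cell k (lower I j) \<subseteq> cell_bd k I"
proof
  fix x assume x: "x \<in> cell k (lower I j)"
  have 0: "x j (I j) = 0" using cell_lower_last[OF x assms] .
  obtain m where m: "I j = Suc m" using assms gr0_implies_Suc by blast
  have "(\<Sum>i\<le>I l. (x l i)\<^sup>2) = 1 \<and> (\<forall>i>I l. x l i = 0) \<and> 0 \<le> x l (I l)" if "l < k" for l
    using x that 0 m assms unfolding cell_def by (cases "l = j") auto
  then have "x \<in> cell k I" using x by (simp add: cell_def)
  then show "x \<in> cell_bd k I" using 0 assms by (auto simp: cell_bd_def)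
qed

lemma flip_cell_lower:
  assumes "j < k" "0 < I j" "x \<in> cell k (lower I j)"
  shows "flip k j x \<in> cell_bd k I"
proof -
  have x: "x \<in> cell k I" using cell_lower_subset[of j k I, OF assms(1,2)] assms(3)
    by (auto simp: cell_bd_def)
  have 0: "x j (I j) = 0" using cell_lower_last[OF assms(3,1,2)] .
  show ?thesis
    using x 0 assms(1)
      by (auto simp: cell_bd_def cell_def flip_apply flip_extensional intro!: exI[of _ j])
qed

text \<open>Among all walls and flipped walls only \<open>lower I j\<close> itself contains its
  pole. This singles out one summand of the boundary cycle in local homology.\<close>

lemma pole_notin_faces:
  assumes "j < k" "0 < I j" "l < k" "0 < I l"
  shows "x \<in> cell k (lower I l) \<Longrightarrow> flip k l x \<noteq> pole k (lower I j)"
    and "l \<noteq> j \<Longrightarrow> pole k (lower I j) \<notin> cell k (lower I l)"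
proof -
  assume x: "x \<in> cell k (lower I l)"
  show "flip k l x \<noteq> pole k (lower I j)"
  proof
    assume "flip k l x = pole k (lower I j)"
    then have eq: "flip k l x l i = pole k (lower I j) l i" for i by simp
    show False
    proof (cases "l = j")
      case True
      have "0 \<le> x j (I j - 1)" using x True assms by (auto simp: cell_def)
      then show False using eq[of "I j - 1"] True assms by (simp add: flip_apply pole_def)
    next
      case False
      then show False
        using eq[of "I l"] cell_lower_last[OF x assms(3,4)] assms by (simp add: flip_apply pole_def)
    qed
  qed
next
  assume "l \<noteq> j"
  show "pole k (lower I j) \<notin> cell k (lower I l)"
  proof
    assume "pole k (lower I j) \<in> cell k (lower I l)"
    from cell_lower_last[OF this assms(3,4)] show False
      using \<open>l \<noteq> j\<close> assms by (simp add: pole_def)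
  qed
qed

text \<open>A boundary point has some vanishing last coordinate, here necessarily that of factor
  \<open>j\<close>; the sign of the coordinate before it selects the unflipped half of the
  equator.\<close>

lemma cell_lower_neighbourhood:
  assumes "j < k" "0 < I j" "x \<in> cell_bd k I" "0 < x j (I j - 1)"
    and "\<And>l. l < k \<Longrightarrow> l \<noteq> j \<Longrightarrow> 0 < x l (I l)"
  shows "x \<in> cell k (lower I j)"
proof -
  have x: "x \<in> cell k I" using assms(3) by (simp add: cell_bd_def)
  obtain l where "l < k" "x l (I l) = 0" using assms(3) by (auto simp: cell_bd_def)
  then have 0: "x j (I j) = 0" using assms(5)[of l] by (cases "l = j") auto
  obtain m where m: "I j = Suc m" using assms gr0_implies_Suc by blast
  have "x j i = 0" if "i > m" for i
  proof (cases "i = Suc m")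
    case False
    then show ?thesis using x that m assms(1) by (simp add: cell_def)
  qed (use 0 m in simp)
  then show ?thesis
    using x assms 0 m unfolding cell_def by auto
qed

text \<open>The set \<open>O'\<close> where all last coordinates of the wall are positive is an open
  neighbourhood of its pole inside the wall. Hence the closure of the complement of the wall misses
  the pole.\<close>

lemma homology_excision_cell_lower:
  assumes "j < k" "0 < I j"
  defines "X \<equiv> subtopology (tuples k) (cell_bd k I)"
  shows "X closure_of (cell_bd k I - cell k (lower I j)) \<subseteq>
    X interior_of (cell_bd k I - {pole k (lower I j)})"
proof -
  have top: "topspace X = cell_bd k I"
    unfolding X_def using subset_trans[OF cell_bd_subset cell_extensional] by auto
  define O' where "O' = {x \<in> topspace X. \<forall>l<k. 0 < x l (lower I j l)}"
  have O': "O' = topspace X \<inter> (\<Inter>l<k. {x \<in> topspace X. x l (lower I j l) \<in> {0<..}})"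
    by (auto simp: O'_def simp del: fun_upd_apply)
  have "openin X {x \<in> topspace X. x l (lower I j l) \<in> {0<..}}" if "l < k" for l
    using that unfolding X_def
    by (intro openin_continuous_map_preimage[where Y = euclideanreal]
      continuous_map_tuples_coordinate) auto
  then have "openin X O'"
    unfolding O' by (cases "k = 0") (auto intro!: openin_Inter openin_Int)
  moreover have "O' \<inter> (cell_bd k I - cell k (lower I j)) = {}"
  proof (intro equals0I)
    fix x assume x: "x \<in> O' \<inter> (cell_bd k I - cell k (lower I j))"
    then have pos: "0 < x l (lower I j l)" if "l < k" for l using that by (simp add: O'_def)
    have "0 < x l (I l)" if "l < k" "l \<noteq> j" for l using pos[OF that(1)] that by simp
    then have "x \<in> cell k (lower I j)"
      using x pos[OF assms(1)] by (intro cell_lower_neighbourhood[of j k I x, OF assms(1,2)]) auto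
    then show False using x by blast
  qed
  ultimately have "X closure_of (cell_bd k I - cell k (lower I j)) \<subseteq> topspace X - O'"
    using closedin_diff[OF closedin_topspace \<open>openin X O'\<close>]
    by (intro closure_of_minimal) (auto simp: top)
  moreover have "pole k (lower I j) \<in> O'"
    using subsetD[OF cell_lower_subset[of j k I, OF assms(1,2)] pole_in_cell]
    by (simp add: O'_def top) (simp add: pole_def)
  moreover have "openin X (cell_bd k I - {pole k (lower I j)})"
  proof -
    have "Hausdorff_space (tuples k)"
      unfolding tuples_def by (simp add: Hausdorff_space_product_topology)
    then have "Hausdorff_space X" unfolding X_def by (rule Hausdorff_space_subtopology)
    then have "closedin X {pole k (lower I j)}"
      using \<open>pole k (lower I j) \<in> O'\<close> by (simp add: closedin_Hausdorff_singleton O'_def)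
    then show ?thesis using top by (metis openin_diff openin_topspace)
  qed
  ultimately show ?thesis by (auto simp: interior_of_openin top)
qed

section \<open>Fundamental chains of the cells\<close>

abbreviation (input) cell_top :: "nat \<Rightarrow> (nat \<Rightarrow> nat) \<Rightarrow> (nat \<Rightarrow> nat \<Rightarrow> real) topology"
  where "cell_top k I \<equiv> subtopology (tuples k) (cell k I)"

abbreviation (input) cell_bd_top :: "nat \<Rightarrow> (nat \<Rightarrow> nat) \<Rightarrow> (nat \<Rightarrow> nat \<Rightarrow> real) topology"
  where "cell_bd_top k I \<equiv> subtopology (tuples k) (cell_bd k I)"

text \<open>The boundary formula together with the coefficient 1 in dimension 0 is the whole
  normalisation; non-divisibility in all dimensions is derived from it.\<close>

definition cell_chains :: "nat \<Rightarrow> ((nat \<Rightarrow> nat) \<Rightarrow> (nat \<Rightarrow> nat \<Rightarrow> real) chain) \<Rightarrow> bool"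
  where "cell_chains k c \<longleftrightarrow> (\<forall>I. singular_chain (weight k I) (cell_top k I) (c I) \<and>
    (weight k I = 0 \<longrightarrow> c I = frag_of (restrict (\<lambda>_. pole k I) (standard_simplex 0))) \<and>
    (0 < weight k I \<longrightarrow>
      chain_boundary (weight k I) (c I) = cube_boundary k (flip k) (weight k I - 1) c I))"

lemma cell_face_chains:
  assumes "j < k" "0 < I j" "singular_chain q (cell_top k (lower I j)) x"
  shows "singular_chain q (cell_bd_top k I) x"
    and "singular_chain q (cell_bd_top k I) (chain_map q (flip k j) x)"
proof -
  show "singular_chain q (cell_bd_top k I) x"
    using assms(3) cell_lower_subset[of j k I, OF assms(1,2)] by (rule singular_chain_mono)
  have "continuous_map (cell_top k (lower I j)) (cell_bd_top k I) (flip k j)"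
    using flip_cell_lower[of j k I, OF assms(1,2)] continuous_map_flip
    by (auto simp: continuous_map_in_subtopology)
  then show "singular_chain q (cell_bd_top k I) (chain_map q (flip k j) x)"
    using assms(3) singular_chain_chain_map by blast
qed

lemma singular_chain_cell_cube_boundary:
  assumes "\<And>j. j < k \<Longrightarrow> 0 < I j \<Longrightarrow> singular_chain q (cell_top k (lower I j)) (c (lower I j))"
  shows "singular_chain q (cell_bd_top k I) (cube_boundary k (flip k) q c I)"
  using assms by (intro singular_chain_cube_boundary cell_face_chains) auto

text \<open>In positive dimension this is the vanishing of the squared cellular boundary; for
  \<open>w = 0\<close> the cell is an arc whose ends carry opposite signs. Only smaller cells enter
  the hypotheses, which makes the lemma usable while the chains are still being constructed.\<close>

lemma reduced_cycle_cell_cube_boundary: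
  assumes w: "weight k I = Suc w"
    and chain: "\<And>J. weight k J < weight k I \<Longrightarrow> singular_chain (weight k J) (cell_top k J) (c J)"
    and bd: "\<And>J. weight k J < weight k I \<Longrightarrow> 0 < weight k J \<Longrightarrow>
      chain_boundary (weight k J) (c J) = cube_boundary k (flip k) (weight k J - 1) c J"
  shows "reduced_cycle w (cell_bd_top k I) (cube_boundary k (flip k) w c I)"
proof -
  have wl: "weight k (lower I j) = w" if "j < k" "0 < I j" for j
    using weight_lower[of j k I, OF that] w by simp
  have ch: "singular_chain w (cell_top k (lower I j)) (c (lower I j))" if "j < k" "0 < I j" for j
    using chain[of "lower I j"] wl[OF that] w by simp
  have "chain_boundary w (cube_boundary k (flip k) w c I) = 0"
  proof (cases w)
    case (Suc v)
    have "chain_boundary w (cube_boundary k (flip k) w c I)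
      = cube_boundary k (flip k) v (\<lambda>J. chain_boundary w (c J)) I"
      using chain_boundary_chain_map[OF ch] Suc
      by (intro cube_boundary_natural) (auto simp: chain_boundary_add chain_boundary_cmul)
    also have "\<dots> = cube_boundary k (flip k) v (cube_boundary k (flip k) v c) I"
    proof (rule cube_boundary_cong)
      fix j assume j: "j < k" "0 < I j"
      show "chain_boundary w (c (lower I j)) = cube_boundary k (flip k) v c (lower I j)"
        using bd[of "lower I j"] wl[OF j] w Suc by simp
    qed
    also have "\<dots> = 0"
    proof (rule cube_boundary_cube_boundary[where Y = "tuples k"])
      fix j l assume jl: "j < k" "0 < I j" "l < k" "0 < lower I j l"
      have "weight k (lower (lower I j) l) = v"
        using weight_lower[of l k "lower I j", OF jl(3,4)] wl[OF jl(1,2)] Suc by simp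
      then have "singular_chain v (cell_top k (lower (lower I j) l)) (c (lower (lower I j) l))"
        using chain[of "lower (lower I j) l"] w Suc by simp
      then show "singular_chain v (tuples k) (c (lower (lower I j) l))"
        by (simp add: singular_chain_subtopology)
    qed (simp_all add: flip_commute flip_flip topspace_tuples)
    finally show ?thesis .
  qed (simp add: chain_boundary_def)
  moreover have "chain_map 0 (\<lambda>_. ()) (cube_boundary k (flip k) w c I) = 0" if "w = 0"
  proof -
    let ?u = "chain_map 0 (\<lambda>_. ())"
    have "?u (c (lower I j)) + frag_cmul ((-1) ^ I j) (?u (c (lower I j))) = 0"
      if "j < k" "0 < I j" for j
    proof -
      have "I j \<le> weight k I" unfolding weight_def using that(1) by (intro member_le_sum) auto
      then have "I j = 1" using that w \<open>w = 0\<close> by simp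
      then have "(-1 :: int) ^ I j = -1" by simp
      then show ?thesis by (simp only: frag_cmul_minus_one add.right_inverse)
    qed
    then have "?u (frag_cmul ((-1) ^ (\<Sum>l<j. I l)) (c (lower I j) +
        frag_cmul ((-1) ^ I j) (chain_map 0 (flip k j) (c (lower I j))))) =
          0" if "j < k" "0 < I j" for j
      unfolding chain_map_cmul chain_map_add chain_map_unit_chain_map using that
        by (metis frag_cmul_zero2)
    then show ?thesis
      unfolding cube_boundary_def \<open>w = 0\<close>
      by (subst chain_map_sum) (auto intro!: sum.neutral simp del: chain_map_cmul)
  qed
  ultimately show ?thesis
    using singular_chain_cell_cube_boundary[of k I w c] ch
    by (simp add: reduced_cycle_def singular_cycle)
qed

lemma weight_pos: "0 < weight k I \<Longrightarrow> \<exists>j<k. 0 < I j"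
  unfolding weight_def by (metis gr0I lessThan_iff less_irrefl sum.neutral)

text \<open>Recursion on the dimension: the prescribed boundary is a reduced cycle, hence it bounds
  in the contractible cell.\<close>

lemma cell_chains_exist: "\<exists>c. cell_chains k c"
proof -
  define good where "good c I x \<longleftrightarrow> singular_chain (weight k I) (cell_top k I) x \<and>
    (weight k I = 0 \<longrightarrow> x = frag_of (restrict (\<lambda>_. pole k I) (standard_simplex 0))) \<and>
    (0 < weight k I \<longrightarrow>
      chain_boundary (weight k I) x = cube_boundary k (flip k) (weight k I - 1) c I)" for c I x
  have "\<exists>c. \<forall>I. good c I (c I)"
  proof (rule dependent_wf_choice[OF wf_measure[of "weight k"]])
    fix f g :: "(nat \<Rightarrow> nat) \<Rightarrow> (nat \<Rightarrow> nat \<Rightarrow> real) chain" and I r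
    assume eq: "\<And>J. (J, I) \<in> measure (weight k) \<Longrightarrow> f J = g J"
    have "cube_boundary k (flip k) (weight k I - 1) f I =
      cube_boundary k (flip k) (weight k I - 1) g I"
    proof (rule cube_boundary_cong)
      fix j assume j: "j < k" "0 < I j"
      show "f (lower I j) = g (lower I j)"
        using weight_lower[of j k I, OF j] by (intro eq) simp
    qed
    then show "good f I r = good g I r" by (simp add: good_def)
  next
    fix I c
    assume "\<And>J. (J, I) \<in> measure (weight k) \<Longrightarrow> good c J (c J)"
    then have c: "\<And>J. weight k J < weight k I \<Longrightarrow> good c J (c J)" by simp
    show "\<exists>r. good c I r"
    proof (cases "weight k I")
      case 0
      have "singular_simplex 0 (cell_top k I) (restrict (\<lambda>_. pole k I) (standard_simplex 0))"
        using subsetD[OF cell_extensional pole_in_cell, of k I] pole_in_cell[of k I]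
        by (simp add: singular_simplex_def)
      then show ?thesis using 0 by (auto simp: good_def singular_chain_of)
    next
      case (Suc w)
      have "reduced_cycle w (cell_bd_top k I) (cube_boundary k (flip k) w c I)"
        using Suc c unfolding good_def by (intro reduced_cycle_cell_cube_boundary) auto
      then have "reduced_cycle w (cell_top k I) (cube_boundary k (flip k) w c I)"
        using singular_cycle_mono[OF _ cell_bd_subset] by (auto simp: reduced_cycle_def)
      then obtain b where "singular_chain (Suc w) (cell_top k I) b"
        "chain_boundary (Suc w) b = cube_boundary k (flip k) w c I"
        using reduced_cycle_boundary trivial_reduced_homology_group_contractible_space contractible_cell
        by metis
      then show ?thesis using Suc by (auto simp: good_def)
    qed
  qed
  then show ?thesis by (auto simp: good_def cell_chains_def)
qed

section \<open>Fundamental chains are not even: local homology at the poles\<close>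

lemma cell_weight_0:
  assumes "weight k I = 0"
  shows "cell k I = {pole k I}"
proof -
  have "x = pole k I" if "x \<in> cell k I" for x
  proof -
    have "I j = 0" if "j < k" for j using assms that by (auto simp: weight_def)
    then have "lift k I x = lift k I (\<lambda>j i. 0)" by (intro lift_cong) auto
    also have "\<dots> = pole k I" by (auto simp: lift_def pole_def fun_eq_iff)
    finally show ?thesis using that by (simp add: lift_cell)
  qed
  then show ?thesis using pole_in_cell by blast
qed

context
  fixes k c
  assumes c: "cell_chains k c"
begin

lemma cell_chain: "singular_chain (weight k I) (cell_top k I) (c I)"
  using c by (simp add: cell_chains_def)

lemma cell_chain_boundary:
  "weight k I = Suc w \<Longrightarrow> chain_boundary (Suc w) (c I) = cube_boundary k (flip k) w c I"
  using c unfolding cell_chains_def by (metis diff_Suc_1 zero_less_Suc)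

lemma reduced_cycle_cell_boundary:
  "weight k I = Suc w \<Longrightarrow> reduced_cycle w (cell_bd_top k I) (cube_boundary k (flip k) w c I)"
  using c by (intro reduced_cycle_cell_cube_boundary) (auto simp: cell_chains_def)

text \<open>The complement of the pole is used in place of \<open>cell_bd\<close> because this is
  the pair that excision produces from the boundary of a larger cell.\<close>

lemma singular_relcycle_cell_chain:
  "singular_relcycle (weight k I) (cell_top k I) (cell k I - {pole k I}) (c I)"
proof (cases "weight k I")
  case 0
  then show ?thesis
    using cell_chain[of I] by (simp add: singular_relcycle chain_boundary_def)
next
  case (Suc w)
  have "singular_chain w (cell_bd_top k I) (chain_boundary (Suc w) (c I))"
    using reduced_cycle_cell_boundary[OF Suc] cell_chain_boundary[OF Suc]
    by (simp add: reduced_cycle_def singular_cycle)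
  then have "singular_chain w (subtopology (tuples k) (cell k I - {pole k I}))
    (chain_boundary (Suc w) (c I))"
    by (rule singular_chain_mono) (use cell_bd_subset pole_notin_cell_bd in blast)
  moreover have "cell k I \<inter> (cell k I - {pole k I}) = cell k I - {pole k I}" by blast
  ultimately show ?thesis
    using cell_chain[of I] Suc by (simp add: singular_relcycle subtopology_subtopology)
qed

lemma not_divisible2_cell_chain_0:
  assumes "weight k I = 0"
  shows "\<not> divisible2 (weight k I) (cell_top k I) (cell k I - {pole k I}) (c I)"
proof -
  have "topspace (cell_top k I) = {pole k I}"
    using cell_weight_0[OF assms] cell_extensional[of k I] by auto
  then show ?thesis
    using not_divisible2_point[of "cell_top k I" "pole k I"] assms c
    by (simp add: cell_chains_def cell_weight_0)
qed

text \<open>Relative to the complement of the pole of \<open>lower I j\<close> every other term of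
  the boundary formula dies, so the cycle becomes the chain of this wall up to sign; excision then
  discards everything outside the wall.\<close>

lemma not_divisible2_cell_boundary:
  assumes j: "j < k" "0 < I j" and w: "weight k I = Suc w"
    and face: "\<not> divisible2 w (cell_top k (lower I j)) (cell k (lower I j) - {pole k (lower I j)}) (c (lower I j))"
  shows "\<not> divisible2 w (cell_bd_top k I) {} (cube_boundary k (flip k) w c I)"
proof
  let ?J = "lower I j" and ?X = "cell_bd_top k I"
  let ?T = "cell_bd k I - {pole k ?J}" and ?U = "cell_bd k I - cell k ?J"
  assume "divisible2 w ?X {} (cube_boundary k (flip k) w c I)"
  then have div: "divisible2 w ?X ?T (cube_boundary k (flip k) w c I)"
    by (rule divisible2_relativize)
  have wl: "weight k (lower I l) = w" if "l < k" "0 < I l" for l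
    using weight_lower[of l k I, OF that] w by simp
  have ch: "singular_chain w (cell_top k (lower I l)) (c (lower I l))" if "l < k" "0 < I l" for l
    using cell_chain[of "lower I l"] unfolding wl[OF that] .
  have sub: "cell k (lower I l) \<subseteq> cell_bd k I" if "l < k" "0 < I l" for l
    using cell_lower_subset[of l k I, OF that] .
  have XT: "subtopology ?X ?T = subtopology (tuples k) ?T"
    by (simp add: subtopology_subtopology Int_absorb1)
  define s where "s l = ((-1) ^ (\<Sum>i<l. I i) :: int)" for l
  let ?F = "\<lambda>l. chain_map w (flip k l) (c (lower I l))"
  have F: "singular_chain w (subtopology ?X ?T) (?F l)" if l: "l < k" "0 < I l" for l
  proof -
    have "flip k l x \<in> ?T" if "x \<in> cell k (lower I l)" for x
      using flip_cell_lower[of l k I, OF l that] pole_notin_faces(1)[of j k I l, OF j l that] by blast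
    then have "continuous_map (cell_top k (lower I l)) (subtopology (tuples k) ?T) (flip k l)"
      using continuous_map_flip by (auto simp: continuous_map_in_subtopology)
    then show ?thesis unfolding XT using ch[OF l] singular_chain_chain_map by blast
  qed
  have G: "singular_chain w (subtopology ?X ?T) (c (lower I l))" if l: "l < k" "0 < I l" "l \<noteq> j" for l
    unfolding XT using ch[OF l(1,2)]
    by (rule singular_chain_mono)
      (use sub[OF l(1,2)] pole_notin_faces(2)[of j k I l, OF j l] in blast)
  \<comment> \<open>The flipped copy of the wall \<open>lower I j\<close> also misses the pole and
    is counted here.\<close>
  define rest where "rest = frag_cmul (s j * (-1) ^ I j) (?F j) +
    (\<Sum>l\<in>{l. l < k \<and> 0 < I l} - {j}. frag_cmul (s l) (c (lower I l) + frag_cmul ((-1) ^ I l) (?F l)))"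
  have "cube_boundary k (flip k) w c I = frag_cmul (s j) (c ?J) + rest"
    unfolding cube_boundary_def rest_def s_def[symmetric] using j
    by (subst sum.remove[of _ j]) (auto simp: frag_cmul_distrib2 add_ac)
  moreover have "singular_chain w (subtopology ?X ?T) rest"
    unfolding rest_def using j
    by (intro singular_chain_add singular_chain_sum singular_chain_cmul F G) auto
  then have "singular_relboundary w ?X ?T (- rest)"
    by (intro singular_chain_imp_relboundary) (simp add: singular_chain_minus)
  ultimately have "divisible2 w ?X ?T (frag_cmul (s j) (c ?J))"
    using divisible2_add_boundary[OF div] by fastforce
  \<comment> \<open>A second factor \<open>s j\<close> removes the sign.\<close>
  then have "divisible2 w ?X ?T (frag_cmul (s j * s j) (c ?J))"
    using divisible2_cmul by fastforce
  moreover have "s j * s j = 1" by (simp add: s_def flip: power_mult_distrib)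
  ultimately have cJ: "divisible2 w ?X ?T (c ?J)" by simp
  have top: "topspace ?X = cell_bd k I"
    using subset_trans[OF cell_bd_subset cell_extensional] by auto
  have "topspace ?X - ?U = cell k ?J" "?T - ?U = cell k ?J - {pole k ?J}"
    unfolding top using sub[OF j] by blast+
  moreover have "subtopology ?X (cell k ?J) = cell_top k ?J"
    using sub[OF j] by (simp add: subtopology_subtopology Int_absorb1)
  ultimately have "divisible2 w (cell_top k ?J) (cell k ?J - {pole k ?J}) (c ?J)"
    using divisible2_excision[OF cJ homology_excision_cell_lower[of j k I, OF j]]
      singular_relcycle_cell_chain[of ?J] wl[OF j] unfolding top by (simp del: fun_upd_apply)
  then show False using face by simp
qed

text \<open>Were the chain even, its boundary would be even in the punctured cell; the radial
  retraction fixes this boundary and carries the divisibility to \<open>cell_bd\<close>.\<close>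

lemma not_divisible2_cell_chain_step:
  assumes w: "weight k I = Suc w"
    and bd: "\<not> divisible2 w (cell_bd_top k I) {} (cube_boundary k (flip k) w c I)"
  shows "\<not> divisible2 (weight k I) (cell_top k I) (cell k I - {pole k I}) (c I)"
proof
  let ?S = "cell k I - {pole k I}"
  assume "divisible2 (weight k I) (cell_top k I) ?S (c I)"
  then have "divisible2 w (subtopology (cell_top k I) ?S) {} (chain_boundary (Suc w) (c I))"
    unfolding w by (rule divisible2_boundary)
  moreover have "continuous_map (subtopology (cell_top k I) ?S) (cell_bd_top k I) (radial k I)"
    unfolding subtopology_subtopology
    by (intro continuous_map_radial continuous_map_tuples_coordinate block_norm_pos_cell) auto
  ultimately have "divisible2 w (cell_bd_top k I) {}
      (chain_map w (radial k I) (cube_boundary k (flip k) w c I))"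
    unfolding cell_chain_boundary[OF w] by (rule divisible2_chain_map) auto
  moreover have "chain_map w (radial k I) (cube_boundary k (flip k) w c I) =
    cube_boundary k (flip k) w c I"
    using reduced_cycle_cell_boundary[OF w]
    by (intro chain_map_id_gen[of _ "cell_bd_top k I"])
      (auto simp: reduced_cycle_def singular_cycle radial_cell_bd)
  ultimately show False using bd by simp
qed

lemma not_divisible2_cell_chain:
  "\<not> divisible2 (weight k I) (cell_top k I) (cell k I - {pole k I}) (c I)"
proof (induction "weight k I" arbitrary: I)
  case 0
  then show ?case using not_divisible2_cell_chain_0 by simp
next
  case (Suc w)
  then have "0 < weight k I" by simp
  then obtain j where j: "j < k" "0 < I j" using weight_pos by blast
  have "w = weight k (lower I j)" using weight_lower[of j k I, OF j] Suc(2) by simp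
  then show ?case
    using Suc j not_divisible2_cell_boundary[of j I w] not_divisible2_cell_chain_step[of I w] by metis
qed

lemma not_divisible2_cell_boundary_cycle:
  assumes w: "weight k I = Suc w"
  shows "\<not> divisible2 w (cell_bd_top k I) {} (cube_boundary k (flip k) w c I)"
proof -
  have "0 < weight k I" using w by simp
  then obtain j where j: "j < k" "0 < I j" using weight_pos by blast
  have "w = weight k (lower I j)" using weight_lower[of j k I, OF j] w by simp
  then show ?thesis
    using not_divisible2_cell_boundary[OF j w] not_divisible2_cell_chain by metis
qed

end

section \<open>The degree of admissible maps\<close>

lemma continuous_map_normalize:
  assumes f: "continuous_map Z (Euclidean_space (Suc M)) f"
    and nz: "\<And>z. z \<in> topspace Z \<Longrightarrow> f z \<noteq> (\<lambda>_. 0)"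
  shows "continuous_map Z (nsphere M) (normalize_map (Suc M) f)"
proof -
  have zero: "f z i = 0" if "z \<in> topspace Z" "i > M" for z i
    using continuous_map_funspace[OF f] that by (auto simp: topspace_Euclidean_space Suc_le_eq)
  have pos: "0 < (\<Sum>l<Suc M. (f z l)\<^sup>2)" if z: "z \<in> topspace Z" for z
  proof -
    obtain i where "f z i \<noteq> 0" using nz[OF z] by auto
    then have "i < Suc M" using zero[OF z, of i] by (metis not_less_eq)
    then show ?thesis using \<open>f z i \<noteq> 0\<close> by (intro sum_pos2[of _ i]) auto
  qed
  have "continuous_map Z euclideanreal (\<lambda>z. f z i)" for i
    using f
      unfolding Euclidean_space_def continuous_map_in_subtopology continuous_map_componentwise_UNIV
    by blast
  then have "continuous_map Z euclideanreal (\<lambda>z. normalize_map (Suc M) f z i)" for i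
    unfolding normalize_map_def using pos by (intro continuous_intros) force+
  moreover have "(\<Sum>i\<le>M. (normalize_map (Suc M) f z i)\<^sup>2) = 1" if "z \<in> topspace Z" for z
    using pos[OF that] unfolding lessThan_Suc_atMost normalize_map_def
    by (simp add: power_divide flip: sum_divide_distrib)
  ultimately show ?thesis
    unfolding nsphere continuous_map_in_subtopology continuous_map_componentwise_UNIV
    using zero by (auto simp: normalize_map_def)
qed

lemma normalize_map_scale:
  assumes "\<And>i. f z i = y i * c" "0 < c" "(\<Sum>i<m. (y i)\<^sup>2) = 1"
  shows "normalize_map m f z = y"
proof -
  have "(\<Sum>i<m. (f z i)\<^sup>2) = c\<^sup>2"
    by (simp add: assms power_mult_distrib flip: sum_distrib_right)
  then show ?thesis using assms by (simp add: normalize_map_def fun_eq_iff)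
qed

section \<open>The boundary of the top cell as a round sphere\<close>

lemma block_norm_cong:
  assumes "\<And>j i. j < k \<Longrightarrow> i < I j \<Longrightarrow> u j i = v j i"
  shows "block_norm I u k = block_norm I v k"
  using assms by (induction k) auto

text \<open>Concatenates the disc coordinates by \<open>q = j * p + i\<close>. The coordinate with
  index \<open>p\<close> of each factor is dropped, since \<open>lift\<close> restores it.\<close>

definition flatten :: "nat \<Rightarrow> nat \<Rightarrow> (nat \<Rightarrow> nat \<Rightarrow> real) \<Rightarrow> nat \<Rightarrow> real"
  where "flatten k p x = (\<lambda>q. if q < k * p then x (q div p) (q mod p) else 0)"

definition unflatten :: "nat \<Rightarrow> (nat \<Rightarrow> real) \<Rightarrow> nat \<Rightarrow> nat \<Rightarrow> real"
  where "unflatten p y = (\<lambda>j i. y (j * p + i))"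

lemma block_index_less:
  assumes "j < k" "i < (p :: nat)"
  shows "j * p + i < k * p"
proof -
  have "j * p + i < Suc j * p" using assms(2) by simp
  also have "\<dots> \<le> k * p" using assms(1) by (intro mult_le_mono1) simp
  finally show ?thesis .
qed

text \<open>Every ray from the origin meets the Euclidean unit sphere and the boundary of the
  product of discs exactly once each; rescaling to one norm or the other gives the two inverse
  maps.\<close>

lemma homeomorphic_maps_nsphere_cell_bd:
  assumes M: "k * p = Suc M"
  shows "homeomorphic_maps (nsphere M) (cell_bd_top k (\<lambda>_. p))
    (\<lambda>y. radial k (\<lambda>_. p) (unflatten p y)) (normalize_map (Suc M) (flatten k p))"
proof -
  let ?I = "\<lambda>_::nat. p"
  have p: "0 < p" using M by (cases p) auto
  have coord: "q div p < k" "q mod p < p" "q div p * p + q mod p = q" if "q < k * p" for q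
    using that p by (auto simp: less_mult_imp_div_less)
  have sphere: "(\<Sum>q<Suc M. (y q)\<^sup>2) = 1" "\<And>q. q \<ge> Suc M \<Longrightarrow> y q = 0"
    if "y \<in> topspace (nsphere M)" for y
    using that unfolding nsphere by (auto simp: lessThan_Suc_atMost)
  have pos: "0 < block_norm ?I (unflatten p y) k" if y: "y \<in> topspace (nsphere M)" for y
  proof -
    obtain q where q: "q < Suc M" "y q \<noteq> 0"
    proof (rule ccontr)
      assume "\<not> thesis"
      then have "(\<Sum>q<Suc M. (y q)\<^sup>2) = 0" using that by (intro sum.neutral) auto
      then show False using sphere(1)[OF y] by simp
    qed
    then show ?thesis
      using coord[of q] M
        by (intro block_norm_pos[of "q div p" k "q mod p"]) (auto simp: unflatten_def)
  qed
  have nz: "flatten k p x \<noteq> (\<lambda>_. 0)" if x: "x \<in> cell_bd k ?I" for x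
  proof
    assume 0: "flatten k p x = (\<lambda>_. 0)"
    obtain j where j: "j < k" "sqrt (\<Sum>i<p. (x j i)\<^sup>2) = 1"
      using block_norm_attained[of ?I x k] block_norm_cell_bd[OF x] by auto
    have "x j i = 0" if "i < p" for i
      using fun_cong[OF 0, of "j * p + i"] block_index_less[OF j(1) that] that p
      by (simp add: flatten_def)
    then show False using j by simp
  qed
  have top: "topspace (cell_bd_top k ?I) = cell_bd k ?I"
    using subset_trans[OF cell_bd_subset cell_extensional] by auto
  have "continuous_map (nsphere M) (cell_bd_top k ?I) (\<lambda>y. radial k ?I (unflatten p y))"
  proof (rule continuous_map_radial)
    fix j i
    show "continuous_map (nsphere M) euclideanreal (\<lambda>y. unflatten p y j i)"
      by (simp add: unflatten_def continuous_map_nsphere_projection)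
  qed (rule pos)
  moreover have "continuous_map (cell_bd_top k ?I) (nsphere M) (normalize_map (Suc M) (flatten k p))"
  proof (rule continuous_map_normalize)
    have "continuous_map (cell_bd_top k ?I) euclideanreal (\<lambda>x. x (q div p) (q mod p))" if "q < k * p"
      for q
      using coord(1)[OF that] by (rule continuous_map_tuples_coordinate)
    then show "continuous_map (cell_bd_top k ?I) (Euclidean_space (Suc M)) (flatten k p)"
      unfolding flatten_def M by (subst continuous_map_componentwise_Euclidean_space) auto
  qed (use nz in \<open>unfold top, blast\<close>)
  moreover have "normalize_map (Suc M) (flatten k p) (radial k ?I (unflatten p y)) = y"
    if y: "y \<in> topspace (nsphere M)" for y
  proof (rule normalize_map_scale)
    let ?b = "block_norm ?I (unflatten p y) k"
    show "0 < inverse ?b" using pos[OF y] by simp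
    fix q
    show "flatten k p (radial k ?I (unflatten p y)) q = y q * inverse ?b"
      using coord[of q] sphere(2)[OF y, of q] M
      by (cases "q < k * p") (auto simp: flatten_def radial_def lift_def unflatten_def divide_inverse)
  qed (rule sphere(1)[OF y])
  moreover have "radial k ?I (unflatten p (normalize_map (Suc M) (flatten k p) x)) = x"
    if x: "x \<in> cell_bd k ?I" for x
  proof -
    define s where "s = sqrt (\<Sum>q<Suc M. (flatten k p x q)\<^sup>2)"
    obtain q where "flatten k p x q \<noteq> 0" using nz[OF x] by auto
    moreover from this have "q < Suc M" using M by (auto simp: flatten_def split: if_splits)
    ultimately have "0 < (\<Sum>q<Suc M. (flatten k p x q)\<^sup>2)" by (intro sum_pos2[of _ q]) auto
    then have s: "0 < s" by (simp add: s_def)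
    let ?u = "unflatten p (normalize_map (Suc M) (flatten k p) x)"
    have u: "?u j i = x j i * inverse s" if "j < k" "i < p" for j i
    proof -
      have "flatten k p x (j * p + i) = x j i"
        using block_index_less[OF that] that by (simp add: flatten_def)
      then show ?thesis by (simp only: unflatten_def normalize_map_def s_def divide_inverse)
    qed
    have "block_norm ?I ?u k = block_norm ?I (\<lambda>j i. x j i * inverse s) k"
      using u by (intro block_norm_cong) auto
    also have "\<dots> = inverse s"
      using s block_norm_cell_bd[OF x] by (simp add: block_norm_scale)
    finally have "radial k ?I ?u = lift k ?I x"
      unfolding radial_def using s u by (intro lift_cong) auto
    then show ?thesis using x by (simp add: lift_cell cell_bd_def)
  qed
  ultimately show ?thesis unfolding homeomorphic_maps_def top by blast
qed

section \<open>Cells inside the product of spheres\<close>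

lemma sphere_product_eq:
  "sphere_product k (\<lambda>_. p) = subtopology (tuples k)
    {x \<in> extensional {..<k}. \<forall>j<k. (\<Sum>i\<le>p. (x j i)\<^sup>2) = 1 \<and> (\<forall>i>p. x j i = 0)}"
proof -
  let ?S = "{x :: nat \<Rightarrow> real. (\<Sum>i\<le>p. x i ^ 2) = 1 \<and> (\<forall>i>p. x i = 0)}"
  have "sphere_product k (\<lambda>_. p) = subtopology (tuples k) (PiE {..<k} (\<lambda>_. ?S))"
    unfolding sphere_product_def tuples_def nsphere by (rule subtopology_product_topology[symmetric])
  also have "PiE {..<k} (\<lambda>_. ?S) = {x \<in> extensional {..<k}. \<forall>j<k. (\<Sum>i\<le>p. (x j i)\<^sup>2) =
    1 \<and> (\<forall>i>p. x j i = 0)}"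
    by (auto simp: PiE_def Pi_def)
  finally show ?thesis .
qed

lemma topspace_sphere_product:
  "topspace (sphere_product k (\<lambda>_. p)) =
    {x \<in> extensional {..<k}. \<forall>j<k. (\<Sum>i\<le>p. (x j i)\<^sup>2) = 1 \<and> (\<forall>i>p. x j i = 0)}"
  unfolding sphere_product_eq by (auto simp: topspace_tuples)

lemma hemisphere_boundary_eq: "hemisphere_boundary k (\<lambda>_. p) = cell_bd_top k (\<lambda>_. p)"
  unfolding hemisphere_boundary_def hemisphere_product_def sphere_product_eq subtopology_subtopology
  by (rule arg_cong[of _ _ "subtopology (tuples k)"]) (auto simp: cell_bd_def cell_def)

lemma cell_subset_sphere_product:
  assumes "\<And>j. j < k \<Longrightarrow> I j \<le> p"
  shows "cell k I \<subseteq> topspace (sphere_product k (\<lambda>_. p))"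
proof
  fix x assume x: "x \<in> cell k I"
  have "(\<Sum>i\<le>p. (x j i)\<^sup>2) = (\<Sum>i\<le>I j. (x j i)\<^sup>2)" if "j < k" for j
    using x assms[OF that] that by (intro sum.mono_neutral_right) (auto simp: cell_def)
  moreover have "x j i = 0" if "j < k" "i > p" for j i
    using x assms[OF that(1)] that by (simp add: cell_def)
  ultimately show "x \<in> topspace (sphere_product k (\<lambda>_. p))"
    using x by (simp add: topspace_sphere_product cell_def)
qed

text \<open>By the bound on the dimension some factor has \<open>I j < p\<close>, so its coordinate
  with index \<open>p\<close> vanishes.\<close>

lemma cell_subset_cell_bd:
  assumes le: "\<And>j. j < k \<Longrightarrow> I j \<le> p" and w: "weight k I < k * p"
  shows "cell k I \<subseteq> cell_bd k (\<lambda>_. p)"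
proof
  fix x assume x: "x \<in> cell k I"
  have "\<exists>j<k. I j < p"
  proof (rule ccontr)
    assume "\<not> (\<exists>j<k. I j < p)"
    then have "I j = p" if "j < k" for j using le[OF that] that by (meson le_neq_implies_less)
    then have "weight k I = k * p" by (simp add: weight_def)
    then show False using w by simp
  qed
  then obtain j where j: "j < k" "I j < p" by blast
  have "0 \<le> x l p" if "l < k" for l
    using x that le[OF that] by (cases "I l = p") (auto simp: cell_def)
  moreover have "x j p = 0" using x j by (simp add: cell_def)
  moreover have "x \<in> topspace (sphere_product k (\<lambda>_. p))"
    using cell_subset_sphere_product[of k I p] le x by blast
  ultimately show "x \<in> cell_bd k (\<lambda>_. p)"
    using j(1) by (auto simp: cell_bd_def cell_def topspace_sphere_product)
qed

section \<open>The action on the sphere of a representation\<close>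

lemma line_action_square: "(line_action k \<alpha> g x)\<^sup>2 = x\<^sup>2"
  by (simp add: line_action_def)

lemma continuous_map_rep_action:
  assumes "length \<beta>s = Suc M"
  shows "continuous_map (nsphere M) (nsphere M) (rep_action k \<beta>s g)"
proof -
  have "continuous_map (nsphere M) euclideanreal (\<lambda>v. rep_action k \<beta>s g v i)" for i
    unfolding rep_action_def line_action_def
    by (cases "i < length \<beta>s"; cases "Z2pair k g (\<beta>s ! i) = 1")
      (auto intro!: continuous_intros continuous_map_nsphere_projection)
  moreover have "(\<Sum>i\<le>M. (rep_action k \<beta>s g v i)\<^sup>2) = (\<Sum>i\<le>M. (v i)\<^sup>2)" for v
    using assms by (intro sum.cong) (auto simp: rep_action_def line_action_square)
  ultimately show ?thesis
    unfolding nsphere[of M] continuous_map_in_subtopology continuous_map_componentwise_UNIV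
    using assms by (auto simp: rep_action_def nsphere)
qed

lemma rep_action_commute:
  "rep_action k \<beta>s g (rep_action k \<beta>s h v) = rep_action k \<beta>s h (rep_action k \<beta>s g v)"
  by (auto simp: rep_action_def line_action_def)

lemma rep_action_involutive:
  assumes "v \<in> topspace (nsphere M)" "length \<beta>s = Suc M"
  shows "rep_action k \<beta>s g (rep_action k \<beta>s g v) = v"
proof
  fix i
  have "v i = 0" if "\<not> i < length \<beta>s" using assms that unfolding nsphere by auto
  then show "rep_action k \<beta>s g (rep_action k \<beta>s g v) i = v i"
    by (auto simp: rep_action_def line_action_def)
qed

lemma normalize_map_equivariant:
  assumes "f (tuple_action k g x) = rep_action k \<beta>s g (f x)" "length \<beta>s = m"
  shows "normalize_map m f (tuple_action k g x) = rep_action k \<beta>s g (normalize_map m f x)"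
proof -
  have "(\<Sum>l<m. (f (tuple_action k g x) l)\<^sup>2) = (\<Sum>l<m. (f x l)\<^sup>2)"
    using assms(2) by (intro sum.cong) (auto simp: assms(1) rep_action_def line_action_square)
  then show ?thesis
    unfolding normalize_map_def by (auto simp: assms(1) rep_action_def line_action_def fun_eq_iff)
qed

lemma chain_map_cube_boundary:
  assumes c: "cell_chains k c" and w: "weight k I = Suc w"
    and f: "\<And>j x. j < k \<Longrightarrow> 0 < I j \<Longrightarrow> x \<in> cell k (lower I j) \<Longrightarrow> f (flip k j x) = \<rho> j (f x)"
  shows "chain_map w f (cube_boundary k (flip k) w c I) =
    cube_boundary k \<rho> w (\<lambda>J. chain_map (weight k J) f (c J)) I"
proof -
  have wl: "weight k (lower I j) = w" if "j < k" "0 < I j" for j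
    using weight_lower[of j k I, OF that] w by simp
  have "chain_map w f (cube_boundary k (flip k) w c I) =
    cube_boundary k \<rho> w (\<lambda>J. chain_map w f (c J)) I"
  proof (rule cube_boundary_natural)
    fix j assume j: "j < k" "0 < I j"
    have "chain_map w (f \<circ> flip k j) (c (lower I j)) = chain_map w (\<rho> j \<circ> f) (c (lower I j))"
    proof (rule chain_map_eq)
      show "singular_chain w (cell_top k (lower I j)) (c (lower I j))"
        using cell_chain[OF c, of "lower I j"] unfolding wl[OF j] .
    qed (use f[OF j] in auto)
    then show "chain_map w f (chain_map w (flip k j) (c (lower I j))) =
      chain_map w (\<rho> j) (chain_map w f (c (lower I j)))"
      by (simp add: chain_map_compose)
  qed (simp_all add: chain_map_add)
  also have "\<dots> = cube_boundary k \<rho> w (\<lambda>J. chain_map (weight k J) f (c J)) I"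
    using wl by (intro cube_boundary_cong) (simp del: fun_upd_apply)
  finally show ?thesis .
qed

lemma admissible_map_degree_even:
  assumes len: "length \<beta>s = k * p" and pos: "0 < k * p"
    and F: "continuous_map (sphere_product k (\<lambda>_. p)) (Euclidean_space (length \<beta>s)) F"
    and F_equiv: "tuple_equivariant k (sphere_product k (\<lambda>_. p)) \<beta>s F"
    and F_nz: "\<And>x. x \<in> topspace (sphere_product k (\<lambda>_. p)) \<Longrightarrow> F x \<noteq> (\<lambda>_. 0)"
    and g: "admissible_map k (\<lambda>_. p) \<beta>s g"
  shows "degree_mod2 (k * p - 1) (hemisphere_boundary k (\<lambda>_. p)) (normalize_map (k * p) g) = 0"
proof -
  \<comment> \<open>\<open>M\<close> is the dimension both of the sphere of the representation and
    of the boundary of the top cell.\<close>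
  obtain M where M: "k * p = Suc M" using pos gr0_implies_Suc by blast
  let ?X = "sphere_product k (\<lambda>_. p)" and ?B = "\<lambda>_::nat. p"
  let ?Fn = "normalize_map (Suc M) F" and ?gn = "normalize_map (Suc M) g"
  let ?\<rho> = "\<lambda>j. rep_action k \<beta>s (Z2gen j)"
  \<comment> \<open>The normalised \<open>g\<close> is a continuous map to the sphere only here; all
    cells of dimension at most \<open>M\<close> lie in this set.\<close>
  define X' where "X' = {x \<in> topspace ?X. g x \<noteq> (\<lambda>_. 0)}"
  have g_cont: "continuous_map ?X (Euclidean_space (Suc M)) g"
    and g_equiv: "tuple_equivariant k ?X \<beta>s g"
    and g_bd: "\<And>x. x \<in> cell_bd k ?B \<Longrightarrow> g x \<noteq> (\<lambda>_. 0)"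
    using g subset_trans[OF cell_bd_subset cell_extensional, of k ?B]
      unfolding admissible_map_def hemisphere_boundary_eq zeros_of_def len M
    by auto
  have gen: "Z2gen j \<in> Z2pow k" if "j < k" for j using that by (auto simp: Z2gen_def Z2pow_def)
  have bd_X: "cell_bd k ?B \<subseteq> topspace ?X"
    using cell_subset_sphere_product[of k ?B p] cell_bd_subset by blast
  have bd_X': "cell_bd k ?B \<subseteq> X'" using bd_X g_bd by (auto simp: X'_def)
  have sub_X: "subtopology ?X S = subtopology (tuples k) S" if "S \<subseteq> topspace ?X" for S
    using that unfolding topspace_sphere_product sphere_product_eq subtopology_subtopology
    by (simp add: Int_absorb1)
  have X'_X: "X' \<subseteq> topspace ?X" by (auto simp: X'_def)
  have top_X': "topspace (subtopology ?X X') = X'" using X'_X by auto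
  have Fn: "continuous_map ?X (nsphere M) ?Fn"
    using F F_nz unfolding len M by (rule continuous_map_normalize)
  have gn: "continuous_map (subtopology (tuples k) X') (nsphere M) ?gn"
    unfolding sub_X[OF X'_X, symmetric]
    using continuous_map_from_subtopology[OF g_cont]
    by (rule continuous_map_normalize) (auto simp: X'_def)
  have Fn_equiv: "?Fn (flip k j x) = ?\<rho> j (?Fn x)" if "j < k" "x \<in> topspace ?X" for j x
    using F_equiv gen that len M
      by (intro normalize_map_equivariant) (auto simp: tuple_equivariant_def)
  \<comment> \<open>At a zero of \<open>g\<close> division by zero makes the normalised value 0, so
    the equation persists there.\<close>
  have gn_equiv: "?gn (flip k j x) = ?\<rho> j (?gn x)" if "j < k" "x \<in> topspace ?X" for j x
    using g_equiv gen that len M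
      by (intro normalize_map_equivariant) (auto simp: tuple_equivariant_def)
  obtain c where c: "cell_chains k c" using cell_chains_exist by blast
  define d where "d I = chain_map (weight k I) ?Fn (c I) - chain_map (weight k I) ?gn (c I)" for I
  define s where "s = cube_boundary k (flip k) M c ?B"
  have wB: "weight k ?B = Suc M" using M by (simp add: weight_def)
  have lower_le: "lower I j l \<le> p" if "\<And>j. j < k \<Longrightarrow> I j \<le> p" "l < k" for I j l
    using that(1)[OF that(2)] by (cases "l = j") auto
  have d_lower: "cube_boundary k ?\<rho> w d I = chain_map w ?Fn (cube_boundary k (flip k) w c I)
      - chain_map w ?gn (cube_boundary k (flip k) w c I)"
    if le: "\<And>j. j < k \<Longrightarrow> I j \<le> p" and w: "weight k I = Suc w" for I w
  proof -
    have sub: "cell k (lower I j) \<subseteq> topspace ?X" if "j < k" "0 < I j" for j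
      using le by (intro cell_subset_sphere_product lower_le)
    have "chain_map w ?Fn (cube_boundary k (flip k) w c I) =
        cube_boundary k ?\<rho> w (\<lambda>J. chain_map (weight k J) ?Fn (c J)) I"
      using sub Fn_equiv by (intro chain_map_cube_boundary[OF c w]) blast
    moreover have "chain_map w ?gn (cube_boundary k (flip k) w c I) =
        cube_boundary k ?\<rho> w (\<lambda>J. chain_map (weight k J) ?gn (c J)) I"
      using sub gn_equiv by (intro chain_map_cube_boundary[OF c w]) blast
    ultimately show ?thesis unfolding d_def cube_boundary_diff by simp
  qed
  \<comment> \<open>Since \<open>F\<close> has no zeros, the top cell \<open>?B\<close> is included;
    its chain makes the image of the boundary cycle bound.\<close>
  have F_chain: "singular_chain (weight k I) (nsphere M) (chain_map (weight k I) ?Fn (c I))"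
    if "\<And>j. j < k \<Longrightarrow> I j \<le> p" for I
  proof (rule singular_chain_chain_map)
    have "cell k I \<subseteq> topspace ?X" using that by (rule cell_subset_sphere_product)
    then show "continuous_map (cell_top k I) (nsphere M) ?Fn"
      using continuous_map_from_subtopology[OF Fn, of "cell k I"] sub_X by simp
  qed (rule cell_chain[OF c])
  have "divisible2 M (nsphere M) {} (cube_boundary k ?\<rho> M d ?B)"
  proof (rule equivariant_family_divisible2[OF wB])
    fix I assume le: "\<And>j. j < k \<Longrightarrow> I j \<le> p" and wM: "weight k I \<le> M"
    have "cell k I \<subseteq> X'"
      using cell_subset_cell_bd[of k I p] le wM M bd_X' by fastforce
    then have "singular_chain (weight k I) (subtopology (tuples k) X') (c I)"
      using cell_chain[OF c] singular_chain_mono by blast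
    then have g_chain: "singular_chain (weight k I) (nsphere M) (chain_map (weight k I) ?gn (c I))"
      using gn singular_chain_chain_map by blast
    show "singular_chain (weight k I) (nsphere M) (d I)"
      unfolding d_def using F_chain[OF le] g_chain by (rule singular_chain_diff)
    assume "0 < weight k I"
    then obtain w where w: "weight k I = Suc w" using gr0_implies_Suc by blast
    show "chain_boundary (weight k I) (d I) = cube_boundary k ?\<rho> (weight k I - 1) d I"
      using d_lower[OF le w] chain_boundary_chain_map[OF cell_chain[OF c, of I], of ?Fn]
        chain_boundary_chain_map[OF cell_chain[OF c, of I], of ?gn] cell_chain_boundary[OF c w] w
      by (simp add: d_def chain_boundary_diff)
  next
    fix I assume "weight k I = 0"
    then show "chain_map 0 (\<lambda>_. ()) (d I) = 0"
      \<comment> \<open>Both images have the augmentation of \<open>c I\<close>, so it cancels in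
        the difference.\<close>
      by (simp add: d_def chain_map_diff chain_map_unit_chain_map)
  next
    fix j l x
    show "continuous_map (nsphere M) (nsphere M) (?\<rho> j)"
      using len M by (intro continuous_map_rep_action) simp
    show "?\<rho> j (?\<rho> l x) = ?\<rho> l (?\<rho> j x)" by (rule rep_action_commute)
    assume "x \<in> topspace (nsphere M)"
    then show "?\<rho> j (?\<rho> j x) = x" using len M by (intro rep_action_involutive) auto
  qed
  then have "divisible2 M (nsphere M) {} (chain_map M ?Fn s - chain_map M ?gn s)"
    using d_lower[OF _ wB] by (simp add: s_def)
  then have "divisible2 M (nsphere M) {} (frag_cmul (-1) (chain_map M ?Fn s - chain_map M ?gn s))"
    by (rule divisible2_cmul)
  moreover have "singular_relboundary M (nsphere M) {} (chain_map M ?Fn s)"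
    unfolding singular_boundary s_def
    using F_chain[of ?B] chain_boundary_chain_map[OF cell_chain[OF c, of ?B], of ?Fn]
      cell_chain_boundary[OF c wB] wB
    by (intro exI[of _ "chain_map (Suc M) ?Fn (c ?B)"]) auto
  ultimately have "divisible2 M (nsphere M) {}
      (frag_cmul (-1) (chain_map M ?Fn s - chain_map M ?gn s) + chain_map M ?Fn s)"
    by (rule divisible2_add_boundary)
  then have div: "divisible2 M (nsphere M) {} (chain_map M ?gn s)" by simp
  define \<phi> where "\<phi> = (\<lambda>y. radial k ?B (unflatten p y))"
  define \<psi> where "\<psi> = normalize_map (Suc M) (flatten k p)"
  have homeo: "homeomorphic_maps (nsphere M) (cell_bd_top k ?B) \<phi> \<psi>"
    unfolding \<phi>_def \<psi>_def using M by (rule homeomorphic_maps_nsphere_cell_bd)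
  have gn_bd: "continuous_map (cell_bd_top k ?B) (nsphere M) ?gn"
    using continuous_map_from_subtopology[OF gn, of "cell_bd k ?B"] bd_X'
    by (simp add: subtopology_subtopology Int_absorb1)
  have s: "reduced_cycle M (cell_bd_top k ?B) s"
    unfolding s_def by (rule reduced_cycle_cell_boundary[OF c wB])
  then have s_chain: "singular_chain M (cell_bd_top k ?B) s"
    by (simp add: reduced_cycle_def singular_cycle)
  have "even (Brouwer_degree2 M (?gn \<circ> \<phi>))"
  proof (rule ccontr)
    \<comment> \<open>The cycle is carried to the round sphere by \<open>\<psi>\<close>, where an
      odd degree would make it even, and then back by \<open>\<phi>\<close>.\<close>
    assume odd: "odd (Brouwer_degree2 M (?gn \<circ> \<phi>))"
    have s_eq: "chain_map M \<phi> (chain_map M \<psi> s) = s"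
    proof -
      have "chain_map M (\<phi> \<circ> \<psi>) s = s"
        using s_chain homeo by (intro chain_map_id_gen) (auto simp: homeomorphic_maps_def)
      then show ?thesis by (simp add: chain_map_compose)
    qed
    have "divisible2 M (nsphere M) {} (chain_map M (?gn \<circ> \<phi>) (chain_map M \<psi> s))"
      using div s_eq by (simp add: chain_map_compose)
    moreover have "continuous_map (nsphere M) (nsphere M) (?gn \<circ> \<phi>)"
      using homeo gn_bd by (auto simp: homeomorphic_maps_def intro: continuous_map_compose)
    moreover have "reduced_cycle M (nsphere M) (chain_map M \<psi> s)"
      using s homeo by (intro reduced_cycle_chain_map) (auto simp: homeomorphic_maps_def)
    ultimately have "divisible2 M (nsphere M) {} (chain_map M \<psi> s)"
      using divisible2_odd_degree odd by blast
    then have "divisible2 M (cell_bd_top k ?B) {} (chain_map M \<phi> (chain_map M \<psi> s))"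
      by (rule divisible2_chain_map) (use homeo in \<open>simp_all add: homeomorphic_maps_def\<close>)
    then show False
      using not_divisible2_cell_boundary_cycle[OF c wB, folded s_def] unfolding s_eq by blast
  qed
  moreover have "degree_mod2 M (cell_bd_top k ?B) ?gn = of_int (Brouwer_degree2 M (?gn \<circ> \<phi>))"
    using gn_bd homeo homeomorphic_maps_map by (intro degree_mod2_eq) auto
  ultimately show ?thesis
    unfolding hemisphere_boundary_eq M by (auto elim!: evenE)
qed

section \<open>Extending maps from the Stiefel manifold\<close>

text \<open>Metrizability supplies the normality that Tietze's theorem asks for.\<close>

lemma metrizable_space_sphere_product: "metrizable_space (sphere_product k ns)"
proof -
  have "metrizable_space (nsphere n)" for n
    unfolding nsphere euclidean_product_topology
    by (intro metrizable_space_subtopology metrizable_space_euclidean)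
  then show ?thesis
    unfolding sphere_product_def metrizable_space_product_topology
    by (auto intro: countable_finite)
qed

lemma continuous_map_sphere_product_coordinate:
  "j < k \<Longrightarrow> continuous_map (sphere_product k (\<lambda>_. p)) euclideanreal (\<lambda>x. x j i)"
  unfolding sphere_product_eq by (rule continuous_map_tuples_coordinate)

lemma continuous_map_tuple_action:
  "continuous_map (sphere_product k (\<lambda>_. p)) (sphere_product k (\<lambda>_. p)) (tuple_action k g)"
proof -
  have "continuous_map (sphere_product k (\<lambda>_. p)) (tuples k) (tuple_action k g)"
    unfolding continuous_map_into_tuples
  proof (intro conjI allI impI)
    fix j i assume "j < k"
    then show "continuous_map (sphere_product k (\<lambda>_. p)) euclideanreal (\<lambda>x. tuple_action k g x j i)"
      by (cases "g j = 1")
        (auto simp: tuple_action_def intro!: continuous_intros continuous_map_sphere_product_coordinate)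
  qed (simp add: tuple_action_def)
  moreover have "tuple_action k g x \<in> topspace (sphere_product k (\<lambda>_. p))"
    if "x \<in> topspace (sphere_product k (\<lambda>_. p))" for x
    using that by (auto simp: topspace_sphere_product tuple_action_def)
  ultimately show ?thesis
    unfolding sphere_product_eq continuous_map_in_subtopology by (auto simp: topspace_tuples)
qed

lemma topspace_stiefel:
  "topspace (stiefel n k) = {x \<in> topspace (sphere_product k (\<lambda>_. n - 1)).
    \<forall>i<k. \<forall>j<k. i \<noteq> j \<longrightarrow> (\<Sum>l<n. x i l * x j l) = 0}"
  by (auto simp: stiefel_def)

lemma closedin_stiefel: "closedin (sphere_product k (\<lambda>_. n - 1)) (topspace (stiefel n k))"
proof -
  let ?X = "sphere_product k (\<lambda>_. n - 1)"
  have "closedin ?X {x \<in> topspace ?X. (\<Sum>l<n. x i l * x j l) \<in> {0}}" if "i < k" "j < k" for i j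
    using that by (intro closedin_continuous_map_preimage[where Y = euclideanreal] continuous_intros
        continuous_map_sphere_product_coordinate) auto
  moreover define P where "P = {(i, j). i < k \<and> j < k \<and> i \<noteq> j}"
  \<comment> \<open>The factor \<open>topspace ?X\<close> takes care of an empty \<open>P\<close>,
    where the intersection over \<open>P\<close> is the whole type.\<close>
  ultimately have "closedin ?X (topspace ?X \<inter>
      (\<Inter>(i, j)\<in>P. {x \<in> topspace ?X. (\<Sum>l<n. x i l * x j l) \<in> {0}}))"
    by (cases "P = {}") (auto intro!: closedin_Int closedin_Inter)
  also have "topspace ?X \<inter> (\<Inter>(i, j)\<in>P. {x \<in> topspace ?X. (\<Sum>l<n. x i l * x j l) \<in> {0}})
      = topspace (stiefel n k)"
    by (auto simp: topspace_stiefel P_def)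
  finally show ?thesis .
qed

section \<open>The group action and averaging\<close>

lemma bit_cases: "(b :: bit) = 0 \<or> b = 1"
  by (cases b) auto

lemma tuple_action_in_stiefel:
  assumes "x \<in> topspace (stiefel n k)"
  shows "tuple_action k g x \<in> topspace (stiefel n k)"
proof -
  have "tuple_action k g x \<in> topspace (sphere_product k (\<lambda>_. n - 1))"
    using assms continuous_map_funspace[OF continuous_map_tuple_action]
      by (auto simp: topspace_stiefel)
  moreover have "(\<Sum>l<n. tuple_action k g x i l * tuple_action k g x j l) =
      (if g i = g j then 1 else -1) * (\<Sum>l<n. x i l * x j l)" if "i < k" "j < k" for i j
    using that bit_cases[of "g i"] bit_cases[of "g j"]
    by (auto simp: tuple_action_def sum_negf)
  ultimately show ?thesis
    using assms by (simp add: topspace_stiefel)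
qed

lemma finite_Z2pow: "finite (Z2pow k)"
proof -
  have "finite {g :: nat \<Rightarrow> bit. \<forall>j. (j \<in> {..<k} \<longrightarrow> g j \<in> {0, 1}) \<and> (j \<notin> {..<k} \<longrightarrow> g j = 0)}"
    by (rule finite_set_of_finite_funs) auto
  then show ?thesis
    by (rule rev_finite_subset) (use bit_cases in \<open>auto simp: Z2pow_def\<close>)
qed

lemma tuple_action_add:
  "tuple_action k g (tuple_action k h x) = tuple_action k (\<lambda>j. g j + h j) x"
proof
  fix j
  show "tuple_action k g (tuple_action k h x) j = tuple_action k (\<lambda>j. g j + h j) x j"
    using bit_cases[of "g j"] bit_cases[of "h j"] by (auto simp: tuple_action_def)
qed

lemma Z2pair_add: "Z2pair k (\<lambda>j. g j + h j) \<alpha> = Z2pair k g \<alpha> + Z2pair k h \<alpha>"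
  by (simp add: Z2pair_def distrib_right sum.distrib del: add_bit_eq_xor mult_bit_eq_and)

lemma line_action_add: "line_action k \<alpha> (\<lambda>j. g j + h j) x = line_action k \<alpha> g (line_action k \<alpha> h x)"
  using bit_cases[of "Z2pair k g \<alpha>"] bit_cases[of "Z2pair k h \<alpha>"]
  unfolding line_action_def Z2pair_add by auto

lemma line_action_self: "line_action k \<alpha> g (line_action k \<alpha> g x) = x"
  by (simp add: line_action_def)

lemma line_action_sum: "line_action k \<alpha> g (\<Sum>i\<in>A. f i) = (\<Sum>i\<in>A. line_action k \<alpha> g (f i))"
  by (simp add: line_action_def sum_negf)

text \<open>Averaging over the group makes an arbitrary extension equivariant.\<close>

lemma equivariant_Tietze:
  assumes f: "continuous_map (stiefel n k) (Euclidean_space m) f"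
    and equiv: "tuple_equivariant k (stiefel n k) \<alpha>s f" and len: "length \<alpha>s = m"
  obtains h where "continuous_map (sphere_product k (\<lambda>_. n - 1)) (Euclidean_space m) h"
    "tuple_equivariant k (sphere_product k (\<lambda>_. n - 1)) \<alpha>s h"
    "\<And>x. x \<in> topspace (stiefel n k) \<Longrightarrow> h x = f x"
proof -
  let ?X = "sphere_product k (\<lambda>_. n - 1)"
  have stiefel: "subtopology ?X (topspace (stiefel n k)) = stiefel n k"
    by (simp add: stiefel_def subtopology_restrict)
  have "\<exists>e. continuous_map ?X euclideanreal e \<and> (\<forall>x\<in>topspace (stiefel n k). e x = f x i)" for i
  proof -
    have "continuous_map (stiefel n k) euclideanreal (\<lambda>x. f x i)"
      using f
        unfolding Euclidean_space_def continuous_map_in_subtopology continuous_map_componentwise_UNIV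
      by blast
    then show ?thesis
      using Tietze_extension_realinterval[of ?X "topspace (stiefel n k)" UNIV "\<lambda>x. f x i"]
        metrizable_imp_normal_space[OF metrizable_space_sphere_product] closedin_stiefel[of k n]
      unfolding stiefel by (metis UNIV_not_empty is_interval_univ subset_UNIV)
  qed
  then obtain e where e: "\<And>i. continuous_map ?X euclideanreal (e i)"
    and ef: "\<And>i x. x \<in> topspace (stiefel n k) \<Longrightarrow> e i x = f x i" by metis
  define N where "N = real (card (Z2pow k))"
  have "(\<lambda>_. 0) \<in> Z2pow k" by (simp add: Z2pow_def)
  then have N: "0 < N" unfolding N_def using finite_Z2pow by (auto simp: card_gt_0_iff)
  \<comment> \<open>Every group element is its own inverse, so the same \<open>g\<close> stands on
    the inside and on the outside of \<open>e\<close>.\<close>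
  define h where "h x = (\<lambda>i. if i < m
    then (\<Sum>g\<in>Z2pow k. line_action k (\<alpha>s ! i) g (e i (tuple_action k g x))) / N else 0)" for x
  show ?thesis
  proof
    have "continuous_map ?X euclideanreal (\<lambda>x. e i (tuple_action k g x))" for i g
      using continuous_map_compose[OF continuous_map_tuple_action e] by (simp add: o_def)
    then have "continuous_map ?X euclideanreal (\<lambda>x. line_action k \<alpha> g (e i (tuple_action k g x)))"
      for \<alpha> i g
      by (cases "Z2pair k g \<alpha> = 1") (auto simp: line_action_def intro!: continuous_intros)
    then show "continuous_map ?X (Euclidean_space m) h"
      unfolding h_def continuous_map_componentwise_Euclidean_space
      using N by (auto intro!: continuous_intros finite_Z2pow)
    show "tuple_equivariant k ?X \<alpha>s h"
      unfolding tuple_equivariant_def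
    proof (intro ballI ext)
      fix a x i assume a: "a \<in> Z2pow k"
      define \<alpha> where "\<alpha> = \<alpha>s ! i"
      let ?t = "\<lambda>g. line_action k \<alpha> g (e i (tuple_action k g x))"
      have "(\<Sum>g\<in>Z2pow k. line_action k \<alpha> g (e i (tuple_action k g (tuple_action k a x))))
        = (\<Sum>g\<in>Z2pow k. line_action k \<alpha> a (?t (\<lambda>j. g j + a j)))"
      proof (intro sum.cong refl)
        fix g
        have "line_action k \<alpha> a (line_action k \<alpha> (\<lambda>j. g j + a j) y) = line_action k \<alpha> g y" for y
          unfolding line_action_add by (simp add: line_action_def)
        then show "line_action k \<alpha> g (e i (tuple_action k g (tuple_action k a x))) =
            line_action k \<alpha> a (?t (\<lambda>j. g j + a j))"
          by (simp add: tuple_action_add)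
      qed
      also have "\<dots> = (\<Sum>g\<in>Z2pow k. line_action k \<alpha> a (?t g))"
      \<comment> \<open>Translation by \<open>a\<close> is an involution of the group.\<close>
      proof (rule sum.reindex_bij_witness[where i = "\<lambda>g j. g j + a j" and j = "\<lambda>g j. g j + a j"])
        fix g assume g: "g \<in> Z2pow k"
        have "g j + a j + a j = g j" for j using bit_cases[of "g j"] bit_cases[of "a j"] by auto
        then show "(\<lambda>j. g j + a j + a j) = g" "(\<lambda>j. g j + a j + a j) = g" by auto
        show "(\<lambda>j. g j + a j) \<in> Z2pow k" "(\<lambda>j. g j + a j) \<in> Z2pow k"
          using g a by (auto simp: Z2pow_def)
      qed simp
      also have "\<dots> = line_action k \<alpha> a (\<Sum>g\<in>Z2pow k. ?t g)" by (simp add: line_action_sum)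
      finally show "h (tuple_action k a x) i = rep_action k \<alpha>s a (h x) i"
        unfolding h_def rep_action_def \<alpha>_def len by (simp add: line_action_def)
    qed
    fix x assume x: "x \<in> topspace (stiefel n k)"
    show "h x = f x"
    proof
      fix i
      show "h x i = f x i"
      proof (cases "i < m")
        case True
        \<comment> \<open>On the Stiefel manifold equivariance of \<open>f\<close> makes every
          summand equal to \<open>f x i\<close>, so averaging keeps the values.\<close>
        have "line_action k (\<alpha>s ! i) g (e i (tuple_action k g x)) = f x i" if g: "g \<in> Z2pow k" for g
        proof -
          have "e i (tuple_action k g x) = f (tuple_action k g x) i"
            using ef tuple_action_in_stiefel[OF x] by blast
          also have "\<dots> = line_action k (\<alpha>s ! i) g (f x i)"
            using equiv g x True len by (simp add: tuple_equivariant_def rep_action_def)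
          finally show ?thesis by (simp add: line_action_self)
        qed
        then show ?thesis using True N by (simp add: h_def N_def)
      next
        case False
        then show ?thesis
          using funcset_mem[OF continuous_map_funspace[OF f] x]
            by (simp add: h_def topspace_Euclidean_space)
      qed
    qed
  qed
qed

section \<open>Inner products and the weights with two nonzero entries\<close>

text \<open>The weight of the inner product of vectors \<open>a\<close> and \<open>b\<close>, which
  changes sign under exactly these two generators when \<open>a \<noteq> b\<close>.\<close>

definition pair_weight :: "nat \<Rightarrow> nat \<Rightarrow> nat \<Rightarrow> bit"
  where "pair_weight a b = (\<lambda>i. if i = a \<or> i = b then 1 else 0)"

lemma pair_weight_inj:
  assumes "a < b" "c < d" "pair_weight a b = pair_weight c d"
  shows "a = c \<and> b = d"
proof -
  have "(i = a \<or> i = b) = (i = c \<or> i = d)" for i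
    using fun_cong[OF assms(3), of i] by (auto simp: pair_weight_def split: if_splits)
  then show ?thesis using assms(1,2) by (metis less_asym less_irrefl)
qed

lemma weight_2_eq:
  "{\<alpha> \<in> Z2pow k. Z2weight k \<alpha> = 2} = {pair_weight a b | a b. a < b \<and> b < k}"
proof (intro Set.set_eqI iffI)
  fix \<alpha> assume "\<alpha> \<in> {\<alpha> \<in> Z2pow k. Z2weight k \<alpha> = 2}"
  then have \<alpha>: "\<alpha> \<in> Z2pow k" "card {j. j < k \<and> \<alpha> j \<noteq> 0} = 2" by (auto simp: Z2weight_def)
  then obtain a b where ab: "{j. j < k \<and> \<alpha> j \<noteq> 0} = {a, b}" "a \<noteq> b" by (auto simp: card_2_iff)
  have "\<alpha> i = pair_weight a b i" for i
  proof (cases "i < k")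
    case True
    then have "\<alpha> i \<noteq> 0 \<longleftrightarrow> i = a \<or> i = b" using ab(1) by blast
    then show ?thesis using bit_cases[of "\<alpha> i"] by (auto simp: pair_weight_def)
  next
    case False
    then have "i \<noteq> a \<and> i \<noteq> b" using ab(1) by blast
    then show ?thesis using False \<alpha>(1) by (simp add: Z2pow_def pair_weight_def)
  qed
  then have "\<alpha> = pair_weight a b" "\<alpha> = pair_weight b a" by (auto simp: pair_weight_def)
  moreover have "a < k" "b < k" using ab(1) by blast+
  ultimately show "\<alpha> \<in> {pair_weight a b | a b. a < b \<and> b < k}"
    using \<open>a \<noteq> b\<close>
      by (cases "a < b") (blast, metis (mono_tags, lifting) linorder_neqE_nat mem_Collect_eq)
next
  fix \<alpha> assume "\<alpha> \<in> {pair_weight a b | a b. a < b \<and> b < k}"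
  then obtain a b where ab: "\<alpha> = pair_weight a b" "a < b" "b < k" by blast
  then have "{j. j < k \<and> \<alpha> j \<noteq> 0} = {a, b}" by (auto simp: pair_weight_def)
  then show "\<alpha> \<in> {\<alpha> \<in> Z2pow k. Z2weight k \<alpha> = 2}"
    using ab by (auto simp: Z2weight_def Z2pow_def pair_weight_def)
qed

text \<open>The support identifies these weights with the two-element subsets of
  \<open>{..<k}\<close>.\<close>

lemma card_weight_2: "card {pair_weight a b | a b. a < b \<and> b < k} = k choose 2"
proof -
  have "bij_betw (\<lambda>\<alpha>. {j. \<alpha> j \<noteq> 0}) {pair_weight a b | a b. a < b \<and> b < k} {S. S \<subseteq> {..<k} \<and> card S =
    2}"
  proof (rule bij_betw_imageI)
    show "inj_on (\<lambda>\<alpha>. {j. \<alpha> j \<noteq> 0}) {pair_weight a b | a b. a < b \<and> b < k}"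
    proof (rule inj_onI)
      fix \<alpha> \<beta> :: "nat \<Rightarrow> bit"
      assume "{j. \<alpha> j \<noteq> 0} = {j. \<beta> j \<noteq> 0}"
      then have "\<alpha> j \<noteq> 0 \<longleftrightarrow> \<beta> j \<noteq> 0" for j by blast
      then have "\<alpha> j = \<beta> j" for j using bit_cases[of "\<alpha> j"] bit_cases[of "\<beta> j"] by metis
      then show "\<alpha> = \<beta>" by auto
    qed
    have supp: "{j. pair_weight a b j \<noteq> 0} = {a, b}" for a b by (auto simp: pair_weight_def)
    have "S \<in> (\<lambda>\<alpha>. {j. \<alpha> j \<noteq> 0}) ` {pair_weight a b | a b. a < b \<and> b < k}"
      if S: "S \<subseteq> {..<k}" "card S = 2" for S
    proof -
      obtain a b where "S = {a, b}" "a \<noteq> b" using S by (auto simp: card_2_iff)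
      then obtain a b where "S = {a, b}" "a < b" by (metis insert_commute linorder_neqE_nat)
      then show ?thesis using supp[of a b] S by (auto intro!: image_eqI[of _ _ "pair_weight a b"])
    qed
    moreover have "{j. \<alpha> j \<noteq> 0} \<in> {S. S \<subseteq> {..<k} \<and> card S = 2}"
      if \<alpha>: "\<alpha> \<in> {pair_weight a b | a b. a < b \<and> b < k}" for \<alpha>
    proof -
      obtain a b where "\<alpha> = pair_weight a b" "a < b" "b < k" using \<alpha> by blast
      then show ?thesis using supp[of a b] by auto
    qed
    ultimately show "(\<lambda>\<alpha>. {j. \<alpha> j \<noteq> 0}) ` {pair_weight a b | a b. a < b \<and> b < k} = {S. S \<subseteq>
      {..<k} \<and> card S = 2}"
      by (intro subset_antisym image_subsetI subsetI) blast+
  qed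
  then show ?thesis by (simp add: bij_betw_same_card n_subsets)
qed

lemma Z2pair_pair_weight:
  assumes "a < b" "b < k"
  shows "Z2pair k g (pair_weight a b) = g a + g b"
proof -
  have "Z2pair k g (pair_weight a b) = (\<Sum>j\<in>{a, b}. g j * pair_weight a b j)"
    unfolding Z2pair_def using assms by (intro sum.mono_neutral_right) (auto simp: pair_weight_def)
  then show ?thesis
    using assms by (simp add: pair_weight_def del: add_bit_eq_xor mult_bit_eq_and sum_mult_of_bool_eq)
qed

lemma line_action_pair_weight:
  assumes "a < b" "b < k"
  shows "(\<Sum>l<n. tuple_action k g x a l * tuple_action k g x b l) =
    line_action k (pair_weight a b) g (\<Sum>l<n. x a l * x b l)"
  using assms bit_cases[of "g a"] bit_cases[of "g b"]
  by (auto simp: line_action_def Z2pair_pair_weight tuple_action_def sum_negf)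

theorem theorem3p3:
  fixes n k m :: nat and \<alpha>s \<gamma>s :: "(nat \<Rightarrow> bit) list"
  assumes "1 \<le> k" and "k \<le> n"
    and "m = k * (n - 1) - (k choose 2)"
    and "length \<alpha>s = m" and "set \<alpha>s \<subseteq> Z2pow k"
    and "distinct \<gamma>s" and "set \<gamma>s = {\<alpha> \<in> Z2pow k. Z2weight k \<alpha> = 2}"
    and "r_invariant k (\<lambda>_. n - 1) (\<alpha>s @ \<gamma>s) = 1"
  shows "\<not> (\<exists>f. continuous_map (stiefel n k) (unit_sphere m) f \<and>
                tuple_equivariant k (stiefel n k) \<alpha>s f)"
proof
  assume "\<exists>f. continuous_map (stiefel n k) (unit_sphere m) f \<and> tuple_equivariant k (stiefel n k) \<alpha>s f"
  then obtain f where f: "continuous_map (stiefel n k) (unit_sphere m) f"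
    and f_equiv: "tuple_equivariant k (stiefel n k) \<alpha>s f" by blast
  let ?N = "k * (n - 1)" and ?\<beta>s = "\<alpha>s @ \<gamma>s"
  show False
  proof (cases "?N = 0")
    case True
    \<comment> \<open>The degenerate case, where \<open>r_invariant\<close> is 1 by convention: the
      target sphere is empty, while the Stiefel manifold contains a point.\<close>
    then have n: "k = 1" "n = 1" "m = 0" using assms(1-3) by auto
    have "(\<lambda>j\<in>{..<1}. \<lambda>i. if i = 0 then 1 else 0) \<in> topspace (stiefel n k)"
      by (auto simp: n topspace_stiefel topspace_sphere_product)
    then show False
      using continuous_map_funspace[OF f] unit_sphere_0 n by auto
  next
    case False
    let ?X = "sphere_product k (\<lambda>_. n - 1)"
    have \<gamma>s: "set \<gamma>s = {pair_weight a b | a b. a < b \<and> b < k}"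
      using assms(7) weight_2_eq by simp
    then have len_\<gamma>: "length \<gamma>s = k choose 2"
      using distinct_card[OF assms(6)] card_weight_2 by simp
    \<comment> \<open>This ensures that the natural-number subtraction in \<open>m\<close> is not
      truncated, so the dimensions add up to \<open>?N\<close>.\<close>
    have "k choose 2 \<le> k * (k - 1)" by (simp add: choose_two)
    also have "\<dots> \<le> ?N" using assms(2) by (intro mult_le_mono diff_le_mono) auto
    finally have len: "length ?\<beta>s = ?N" using len_\<gamma> assms(3,4) by simp
    obtain h where h: "continuous_map ?X (Euclidean_space m) h"
      and h_equiv: "tuple_equivariant k ?X \<alpha>s h"
      and hf: "\<And>x. x \<in> topspace (stiefel n k) \<Longrightarrow> h x = f x"
      using equivariant_Tietze[OF _ f_equiv assms(4)] f
      unfolding unit_sphere_def continuous_map_in_subtopology by metis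
    \<comment> \<open>The order of \<open>\<gamma>s\<close> is arbitrary, so each position is
      assigned its pair of vectors.\<close>
    have "\<forall>i<length \<gamma>s. \<exists>ab. \<gamma>s ! i = pair_weight (fst ab) (snd ab) \<and> fst ab < snd ab \<and> snd ab < k"
      using \<gamma>s nth_mem by fastforce
    then obtain ab where ab: "\<And>i. i < length \<gamma>s \<Longrightarrow>
        \<gamma>s ! i = pair_weight (fst (ab i)) (snd (ab i)) \<and> fst (ab i) < snd (ab i) \<and> snd (ab i) < k"
      by metis
    define F where "F x = (\<lambda>i. if i < length ?\<beta>s then (if i < m then h x i
      else (\<Sum>l<n. x (fst (ab (i - m))) l * x (snd (ab (i - m))) l)) else 0)" for x :: "nat \<Rightarrow> nat \<Rightarrow> real"
    have F: "continuous_map ?X (Euclidean_space (length ?\<beta>s)) F"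
      unfolding F_def continuous_map_componentwise_Euclidean_space
    proof (intro allI impI)
      fix i assume i: "i < length ?\<beta>s"
      show "continuous_map ?X euclideanreal (\<lambda>x. if i < m then h x i
          else (\<Sum>l<n. x (fst (ab (i - m))) l * x (snd (ab (i - m))) l))"
      proof (cases "i < m")
        case True
        then show ?thesis
          using h unfolding Euclidean_space_def continuous_map_in_subtopology
            continuous_map_componentwise_UNIV by simp
      next
        case False
        then have "i - m < length \<gamma>s" using i assms(4) by simp
        from ab[OF this] have "fst (ab (i - m)) < k" "snd (ab (i - m)) < k" by auto
        then show ?thesis
          using False by (auto intro!: continuous_intros continuous_map_sphere_product_coordinate)
      qed
    qed
    have F_equiv: "tuple_equivariant k ?X ?\<beta>s F"
      unfolding tuple_equivariant_def
    proof (intro ballI ext)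
      fix g x i assume g: "g \<in> Z2pow k" and x: "x \<in> topspace ?X"
      consider "i < m" | "m \<le> i" "i < length ?\<beta>s" | "length ?\<beta>s \<le> i" by linarith
      then show "F (tuple_action k g x) i = rep_action k ?\<beta>s g (F x) i"
      proof cases
        case 1
        then show ?thesis
          using h_equiv g x assms(4)
          by (simp add: F_def tuple_equivariant_def rep_action_def nth_append)
      next
        case 2
        then have "i - m < length \<gamma>s" using assms(4) by simp
        from ab[OF this] show ?thesis
          using 2 assms(4) line_action_pair_weight[of "fst (ab (i - m))" "snd (ab (i - m))" k g x n]
          by (simp add: F_def rep_action_def nth_append)
      next
        case 3
        then show ?thesis by (simp add: F_def rep_action_def)
      qed
    qed
    have F_nz: "F x \<noteq> (\<lambda>_. 0)" if x: "x \<in> topspace ?X" for x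
    proof
      assume 0: "F x = (\<lambda>_. 0)"
      have "(\<Sum>l<n. x a l * x b l) = 0" if "a < b" "b < k" for a b
      proof -
        have "pair_weight a b \<in> set \<gamma>s" using \<gamma>s that by blast
        then obtain i where i: "i < length \<gamma>s" "\<gamma>s ! i = pair_weight a b"
          by (auto simp: in_set_conv_nth)
        then have "fst (ab i) = a \<and> snd (ab i) = b"
          using ab[OF i(1)] that(1) by (metis pair_weight_inj)
        then show ?thesis using fun_cong[OF 0, of "i + m"] i assms(4) by (simp add: F_def)
      qed
      note orth = this
      have "(\<Sum>l<n. x a l * x b l) = 0" if "a < k" "b < k" "a \<noteq> b" for a b
      proof (cases "a < b")
        case False
        then have "(\<Sum>l<n. x b l * x a l) = 0" using orth that by simp
        then show ?thesis by (simp only: mult.commute)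
      qed (use orth that in simp)
      \<comment> \<open>A zero of all inner products is an orthonormal tuple, and there
        \<open>h\<close> agrees with \<open>f\<close>, which has norm 1.\<close>
      then have xs: "x \<in> topspace (stiefel n k)" using x by (simp add: topspace_stiefel)
      then have "f x i = 0" if "i < m" for i
        using fun_cong[OF 0, of i] that hf assms(4) by (simp add: F_def)
      moreover have "(\<Sum>i<m. (f x i)\<^sup>2) = 1"
        using continuous_map_funspace[OF f] xs by (auto simp: unit_sphere_def)
      ultimately show False by simp
    qed
    \<comment> \<open>\<open>F\<close> is itself admissible, so the description operator in
      \<open>r_invariant\<close> has a value to pick; by evenness it is 0.\<close>
    have "admissible_map k (\<lambda>_. n - 1) ?\<beta>s F"
    proof -
      have "topspace (hemisphere_boundary k (\<lambda>_. n - 1)) \<subseteq> topspace ?X"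
        by (auto simp: hemisphere_boundary_def hemisphere_product_def)
      then show ?thesis
        using F F_equiv F_nz unfolding admissible_map_def zeros_of_def by blast
    qed
    then have "(THE d. \<exists>g. admissible_map k (\<lambda>_. n - 1) ?\<beta>s g \<and>
        d = degree_mod2 (?N - 1) (hemisphere_boundary k (\<lambda>_. n - 1)) (normalize_map ?N g)) = 0"
      using admissible_map_degree_even[OF len _ F F_equiv F_nz] False
      by (intro the_equality) auto
    then have "r_invariant k (\<lambda>_. n - 1) ?\<beta>s = 0"
      using False by (simp add: r_invariant_def Let_def)
    then show False using assms(8) by simp
  qed
qed

end
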